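(* Let $\Bbbk$ be an algebraically closed field of characteristic $0$, let $\Omega\in\Bbbk[x_1,x_2,x_3]$ be a nonzero homogeneous polynomial of degree $3$, and let $P=\Bbbk[x_1,x_2,x_3]$ be the Poisson algebra with bracket determined by \[ \{x_1,x_2\}=\frac{\partial\Omega}{\partial x_3},\quad \{x_2,x_3\}=\frac{\partial\Omega}{\partial x_1},\quad \{x_3,x_1\}=\frac{\partial\Omega}{\partial x_2} \] (a unimodular quadratic Poisson algebra). Let $G\subseteq \mathrm{PAut}_{\mathrm{gr}}(P)$ be a finite subgroup. Then the invariant subalgebra $P^G$ is isomorphic to $P$ as Poisson algebras if and only if $G$ is trivial.
   Context: $P$ carries the standard grading ($\deg x_i=1$). A graded Poisson automorphism of $P$ is a bijective algebra homomorphism $\phi:P\to P$ preserving the bracket and with $\phi(P_i)=P_i$ for all $i$; these form the group $\mathrm{PAut}_{\mathrm{gr}}(P)$. For $G\subseteq \mathrm{PAut}_{\mathrm{gr}}(P)$, $P^G=\{a\in P:\phi(a)=a \text{ for all }\phi\in G\}$, a Poisson subalgebra of $P$ with the restricted bracket. A Poisson isomorphism is an algebra isomorphism that is also a Lie algebra isomorphism. *)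

theory Defs
  imports "HOL-Library.Poly_Mapping" "HOL-Library.Product_Plus"
          "HOL-Computational_Algebra.Polynomial"
begin

text \<open>The polynomial ring k[x1,x2,x3]: finitely supported maps from exponent
  vectors (a,b,c) (standing for x1^a x2^b x3^c) to coefficients.\<close>
type_synonym mon3 = "nat \<times> nat \<times> nat"
type_synonym 'k poly3 = "mon3 \<Rightarrow>\<^sub>0 'k"

definition alg_closed_field :: "'k::field itself \<Rightarrow> bool" where
  "alg_closed_field _ \<longleftrightarrow> (\<forall>p :: 'k poly. degree p > 0 \<longrightarrow> (\<exists>x. poly p x = 0))"

definition mdeg :: "mon3 \<Rightarrow> nat" where
  "mdeg m = (case m of (a, b, c) \<Rightarrow> a + b + c)"

definition homog_comp :: "nat \<Rightarrow> ('k::zero) poly3 set" where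
  "homog_comp i = {f. \<forall>m \<in> Poly_Mapping.keys f. mdeg m = i}"

definition var3 :: "nat \<Rightarrow> ('k::{zero,one}) poly3" where
  "var3 i = Poly_Mapping.single (if i = 1 then (1,0,0) else if i = 2 then (0,1,0) else (0,0,1)) 1"

definition smult3 :: "'k::comm_ring_1 \<Rightarrow> 'k poly3 \<Rightarrow> 'k poly3" where
  "smult3 c f = Poly_Mapping.single (0,0,0) c * f"

definition pd1 :: "('k::comm_ring_1) poly3 \<Rightarrow> 'k poly3" where
  "pd1 f = (\<Sum>m\<in>Poly_Mapping.keys f. case m of (a,b,c) \<Rightarrow>
             Poly_Mapping.single (a - 1, b, c) (of_nat a * Poly_Mapping.lookup f m))"
definition pd2 :: "('k::comm_ring_1) poly3 \<Rightarrow> 'k poly3" where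
  "pd2 f = (\<Sum>m\<in>Poly_Mapping.keys f. case m of (a,b,c) \<Rightarrow>
             Poly_Mapping.single (a, b - 1, c) (of_nat b * Poly_Mapping.lookup f m))"
definition pd3 :: "('k::comm_ring_1) poly3 \<Rightarrow> 'k poly3" where
  "pd3 f = (\<Sum>m\<in>Poly_Mapping.keys f. case m of (a,b,c) \<Rightarrow>
             Poly_Mapping.single (a, b, c - 1) (of_nat c * Poly_Mapping.lookup f m))"

text \<open>The Jacobian Poisson bracket with potential Omega: the unique biderivation with
  {x1,x2} = d3 Omega, {x2,x3} = d1 Omega, {x3,x1} = d2 Omega, i.e.
  {f,g} = sum_{i,j} (d_i f)(d_j g){x_i,x_j}.\<close>
definition pbr :: "('k::comm_ring_1) poly3 \<Rightarrow> 'k poly3 \<Rightarrow> 'k poly3 \<Rightarrow> 'k poly3" where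
  "pbr \<Omega> f g =
     pd3 \<Omega> * (pd1 f * pd2 g - pd2 f * pd1 g)
   + pd1 \<Omega> * (pd2 f * pd3 g - pd3 f * pd2 g)
   + pd2 \<Omega> * (pd3 f * pd1 g - pd1 f * pd3 g)"

definition alg_hom_on :: "('k::comm_ring_1) poly3 set \<Rightarrow> ('k poly3 \<Rightarrow> 'k poly3) \<Rightarrow> bool" where
  "alg_hom_on A \<phi> \<longleftrightarrow>
     \<phi> 1 = 1 \<and>
     (\<forall>f\<in>A. \<forall>g\<in>A. \<phi> (f + g) = \<phi> f + \<phi> g \<and> \<phi> (f * g) = \<phi> f * \<phi> g) \<and>
     (\<forall>c. \<forall>f\<in>A. \<phi> (smult3 c f) = smult3 c (\<phi> f))"

definition graded_poisson_aut :: "('k::comm_ring_1) poly3 \<Rightarrow> ('k poly3 \<Rightarrow> 'k poly3) \<Rightarrow> bool" where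
  "graded_poisson_aut \<Omega> \<phi> \<longleftrightarrow>
     bij \<phi> \<and> alg_hom_on UNIV \<phi> \<and>
     (\<forall>f g. \<phi> (pbr \<Omega> f g) = pbr \<Omega> (\<phi> f) (\<phi> g)) \<and>
     (\<forall>i. \<phi> ` homog_comp i = homog_comp i)"

definition is_subgroup_fun :: "('a \<Rightarrow> 'a) set \<Rightarrow> bool" where
  "is_subgroup_fun G \<longleftrightarrow> id \<in> G \<and> (\<forall>\<phi>\<in>G. \<forall>\<psi>\<in>G. \<phi> \<circ> \<psi> \<in> G) \<and>
     (\<forall>\<phi>\<in>G. bij \<phi> \<and> inv \<phi> \<in> G)"

definition invariants :: "('a \<Rightarrow> 'a) set \<Rightarrow> 'a set" where
  "invariants G = {a. \<forall>\<phi>\<in>G. \<phi> a = a}"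

definition poisson_iso_onto_P :: "('k::comm_ring_1) poly3 \<Rightarrow> 'k poly3 set \<Rightarrow> ('k poly3 \<Rightarrow> 'k poly3) \<Rightarrow> bool" where
  "poisson_iso_onto_P \<Omega> A \<psi> \<longleftrightarrow>
     bij_betw \<psi> A UNIV \<and> alg_hom_on A \<psi> \<and>
     (\<forall>f\<in>A. \<forall>g\<in>A. \<psi> (pbr \<Omega> f g) = pbr \<Omega> (\<psi> f) (\<psi> g))"

end

theory Submission
  imports Defs "HOL-Library.Product_Lexorder"
begin

text \<open>A Poisson isomorphism onto \<open>P\<close> inverts to an injective Poisson endomorphism \<open>\<sigma>\<close> of \<open>P\<close> with image
  \<open>P\<^sup>G\<close>. Put \<open>y\<^sub>i = \<sigma> x\<^sub>i\<close> and let \<open>J\<close> be the Jacobian determinant of \<open>y\<close>. Since \<open>{f, g}\<close> is the Jacobian of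
  \<open>(f, g, \<Omega>)\<close>, compatibility with the bracket says \<open>d(\<sigma> \<Omega>) = J d\<Omega>\<close>. Differentiating the orbit polynomials of
  the \<open>x\<^sub>i\<close> shows that \<open>J\<close> divides a product of linear forms \<open>x\<^sub>i - \<phi> x\<^sub>i\<close>, so \<open>J\<close> is itself a product of \<open>N\<close> linear
  forms. If \<open>N = 0\<close>, the linear parts of the \<open>y\<^sub>i\<close> are independent invariant linear forms, and \<open>G\<close> is trivial.

  Otherwise Euler's identity gives \<open>(N + 3) \<sigma> \<Omega> = 3 J \<Omega>\<close>, whence \<open>J\<^sup>3\<close> is proportional to \<open>\<Omega>\<^sup>N\<close> and
  \<open>\<Omega> = l\<^sub>1 l\<^sub>2 l\<^sub>3\<close> for linear forms \<open>l\<^sub>i\<close>. If a linear form \<open>l\<close> divides some \<open>\<sigma> l\<^sub>j\<close> exactly \<open>a > 0\<close> times, then it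
  divides \<open>J\<close> exactly \<open>a - 1\<close> times, because the finite map \<open>y\<close> is generically unramified along the plane
  \<open>l = 0\<close>. Counting multiplicities forces the \<open>l\<^sub>i\<close> to be pairwise non-proportional and \<open>\<sigma> l\<^sub>j\<close> to be a scalar times
  the \<open>e\<close>-th power of one of them, with \<open>e = N / 3 + 1 \<ge> 2\<close> and each \<open>l\<^sub>i\<close> occurring once. If the \<open>l\<^sub>i\<close> are
  independent, comparing Jacobians gives \<open>e\<^sup>3 = \<plusminus> e\<close>; if they are dependent, differentiating the linear relation
  between their images along a plane makes one of them divide another. Both are absurd.\<close>

section \<open>Leading monomials\<close>

text \<open>Cancellation keeps a strict inequality between first components strict under addition,
  so the lexicographic order on exponent vectors respects multiplication of monomials.\<close>

instance prod :: ("{ordered_cancel_comm_monoid_add, linorder}",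
    "{ordered_cancel_comm_monoid_add, linorder}") ordered_cancel_comm_monoid_add
proof
  fix a b c :: "'a \<times> 'b"
  assume "a \<le> b"
  then show "c + a \<le> c + b"
    by (cases a; cases b; cases c)
      (auto simp: less_eq_prod_def add_strict_left_mono add_left_mono)
qed

abbreviation cst :: "'k::zero \<Rightarrow> 'k poly3" where
  "cst c \<equiv> Poly_Mapping.single 0 c"

abbreviation X1 :: "'k::zero_neq_one poly3" where "X1 \<equiv> var3 (Suc 0)"
abbreviation X2 :: "'k::zero_neq_one poly3" where "X2 \<equiv> var3 2"
abbreviation X3 :: "'k::zero_neq_one poly3" where "X3 \<equiv> var3 3"

lemma zero_mon3: "(0, 0, 0) = (0 :: mon3)"
  by (simp add: zero_prod_def)

lemma poly_mapping_eq_sum_single: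
  "f = (\<Sum>m\<in>Poly_Mapping.keys f. Poly_Mapping.single m (Poly_Mapping.lookup f m))"
  by (rule poly_mapping_eqI)
    (auto simp: lookup_sum lookup_single when_def sum.delta in_keys_iff)

lemma poly_mapping_single_induct [case_names single add]:
  fixes f :: "'a \<Rightarrow>\<^sub>0 'b::comm_monoid_add"
  assumes "\<And>m c. Q (Poly_Mapping.single m c)" and "\<And>f g. Q f \<Longrightarrow> Q g \<Longrightarrow> Q (f + g)"
  shows "Q f"
proof -
  have "Q (\<Sum>m\<in>A. Poly_Mapping.single m (Poly_Mapping.lookup f m))" if "finite A" for A
    using that
  proof induction
    case empty
    show ?case using assms(1)[of _ 0] by simp
  qed (auto intro: assms)
  then show ?thesis
    by (subst poly_mapping_eq_sum_single) simp
qed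

lemma single_eq_monomial:
  fixes c :: "'k::comm_ring_1"
  shows "Poly_Mapping.single (a, b, d) c = cst c * X1 ^ a * X2 ^ b * X3 ^ d"
proof -
  have "(X1 :: 'k poly3) ^ n = Poly_Mapping.single (n, 0, 0) 1" for n
    by (induction n) (auto simp: var3_def mult_single zero_mon3 simp flip: single_one)
  moreover have "(X2 :: 'k poly3) ^ n = Poly_Mapping.single (0, n, 0) 1" for n
    by (induction n) (auto simp: var3_def mult_single zero_mon3 simp flip: single_one)
  moreover have "(X3 :: 'k poly3) ^ n = Poly_Mapping.single (0, 0, n) 1" for n
    by (induction n) (auto simp: var3_def mult_single zero_mon3 simp flip: single_one)
  ultimately show ?thesis
    by (simp add: mult_single)
qed

lemma poly3_induct [case_names cst var1 var2 var3 add mult]: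
  fixes Q :: "('k::comm_ring_1) poly3 \<Rightarrow> bool"
  assumes "\<And>c. Q (cst c)" and "Q X1" "Q X2" "Q X3"
    and "\<And>f g. Q f \<Longrightarrow> Q g \<Longrightarrow> Q (f + g)" and "\<And>f g. Q f \<Longrightarrow> Q g \<Longrightarrow> Q (f * g)"
  shows "Q f"
proof (induction f rule: poly_mapping_single_induct)
  case (single m c)
  have pow: "Q (g ^ n)" if "Q g" for g n
    using that assms(1)[of 1] by (induction n) (auto intro: assms(6))
  show ?case
    by (cases m) (simp only: single_eq_monomial, intro assms pow)
qed (rule assms)

text \<open>Leading monomial for the lexicographic order; unspecified at \<open>0\<close>.\<close>

definition ldm :: "'k::zero poly3 \<Rightarrow> mon3" where
  "ldm f = Max (Poly_Mapping.keys f)"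

lemma ldm_in_keys: "f \<noteq> 0 \<Longrightarrow> ldm f \<in> Poly_Mapping.keys f"
  by (simp add: ldm_def)

lemma keys_le_ldm: "m \<in> Poly_Mapping.keys f \<Longrightarrow> m \<le> ldm f"
  by (simp add: ldm_def)

lemma lookup_mult_keys:
  "Poly_Mapping.lookup (f * g) k =
    (\<Sum>a\<in>Poly_Mapping.keys f. \<Sum>b\<in>Poly_Mapping.keys g.
      (Poly_Mapping.lookup f a * Poly_Mapping.lookup g b when a + b = k))"
proof -
  have "f * g = (\<Sum>a\<in>Poly_Mapping.keys f. Poly_Mapping.single a (Poly_Mapping.lookup f a)) *
      (\<Sum>b\<in>Poly_Mapping.keys g. Poly_Mapping.single b (Poly_Mapping.lookup g b))"
    by (simp flip: poly_mapping_eq_sum_single)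
  also have "\<dots> = (\<Sum>a\<in>Poly_Mapping.keys f. \<Sum>b\<in>Poly_Mapping.keys g.
      Poly_Mapping.single (a + b) (Poly_Mapping.lookup f a * Poly_Mapping.lookup g b))"
    by (simp add: sum_product mult_single)
  finally show ?thesis
    by (simp add: lookup_sum lookup_single)
qed

text \<open>By cancellation only the pair \<open>(m, n)\<close> contributes. The bounds need not be
  attained, which admits factors such as \<open>X1 * pd1 f\<close>, whose coefficient at
  \<open>ldm f\<close> may vanish.\<close>

lemma lookup_mult_top:
  fixes f g :: "('k::comm_ring_1) poly3"
  assumes f: "\<And>a. a \<in> Poly_Mapping.keys f \<Longrightarrow> a \<le> m"
    and g: "\<And>b. b \<in> Poly_Mapping.keys g \<Longrightarrow> b \<le> n"
  shows "Poly_Mapping.lookup (f * g) (m + n) = Poly_Mapping.lookup f m * Poly_Mapping.lookup g n"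
proof -
  have *: "a = m \<and> b = n" if "a \<in> Poly_Mapping.keys f" "b \<in> Poly_Mapping.keys g" "a + b = m + n" for a b
    using f[OF that(1)] g[OF that(2)] that(3)
    by (metis add_less_le_mono add_left_cancel order_le_less order_less_irrefl)
  have "Poly_Mapping.lookup (f * g) (m + n) =
    (\<Sum>a\<in>Poly_Mapping.keys f. \<Sum>b\<in>Poly_Mapping.keys g.
      (if a = m then if b = n then Poly_Mapping.lookup f m * Poly_Mapping.lookup g n else 0 else 0))"
    unfolding lookup_mult_keys using * by (intro sum.cong refl) (auto simp: when_def)
  also have "\<dots> = (\<Sum>a\<in>Poly_Mapping.keys f. if a = m then
      \<Sum>b\<in>Poly_Mapping.keys g. if b = n then Poly_Mapping.lookup f m * Poly_Mapping.lookup g n else 0 else 0)"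
    by (intro sum.cong) auto
  also have "\<dots> = Poly_Mapping.lookup f m * Poly_Mapping.lookup g n"
    by (auto simp: sum.delta in_keys_iff)
  finally show ?thesis .
qed

lemma ldm_mult:
  fixes f g :: "('k::idom) poly3"
  assumes "f \<noteq> 0" "g \<noteq> 0"
  shows "ldm (f * g) = ldm f + ldm g"
proof -
  have "Poly_Mapping.lookup (f * g) (ldm f + ldm g) \<noteq> 0"
    using ldm_in_keys[OF assms(1)] ldm_in_keys[OF assms(2)]
    by (subst lookup_mult_top) (auto simp: keys_le_ldm)
  then have "ldm f + ldm g \<in> Poly_Mapping.keys (f * g)"
    by (simp add: in_keys_iff)
  moreover have "k \<le> ldm f + ldm g" if k: "k \<in> Poly_Mapping.keys (f * g)" for k
  proof -
    obtain a b where "k = a + b" "a \<in> Poly_Mapping.keys f" "b \<in> Poly_Mapping.keys g"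
      using k keys_mult[of f g] by blast
    then show ?thesis by (simp add: add_mono keys_le_ldm)
  qed
  ultimately show ?thesis
    unfolding ldm_def[of "f * g"] by (intro Max_eqI) auto
qed

lemma ldm_eq_0_imp_cst:
  assumes "ldm f = 0"
  shows "f = cst (Poly_Mapping.lookup f 0)"
proof -
  have "m = 0" if "m \<in> Poly_Mapping.keys f" for m
    using keys_le_ldm[OF that] assms by (cases m) (auto simp: less_eq_prod_def zero_prod_def)
  then show ?thesis
    by (intro poly_mapping_eqI) (auto simp: lookup_single when_def in_keys_iff)
qed

text \<open>Leading monomials add up and exponents are natural numbers, so both factors of a nonzero
  constant have leading monomial \<open>0\<close>.\<close>

lemma mult_eq_cst_imp_cst:
  fixes f g :: "('k::idom) poly3"
  assumes "f * g = cst c" "c \<noteq> 0"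
  shows "\<exists>d. f = cst d"
proof -
  have nz: "f \<noteq> 0" "g \<noteq> 0"
    using assms by (auto simp: single_zero dest: arg_cong[where f = "\<lambda>h. Poly_Mapping.lookup h 0"])
  then have "ldm f + ldm g = ldm (cst c)"
    using ldm_mult assms(1) by metis
  also have "\<dots> = 0"
    using assms(2) by (simp add: ldm_def)
  finally have "ldm f = 0"
    by (cases "ldm f"; cases "ldm g") (auto simp: zero_prod_def)
  then show ?thesis
    using ldm_eq_0_imp_cst by blast
qed

section \<open>Derivations, Jacobians and homogeneous components\<close>

lemma eq_Suc_pred_iff: "n = Suc (n - Suc 0) \<longleftrightarrow> n \<noteq> 0"
  by (cases n) auto

lemma lookup_pd1:
  "Poly_Mapping.lookup (pd1 f) (a, b, c) = of_nat (Suc a) * Poly_Mapping.lookup f (Suc a, b, c)"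
proof -
  have "Poly_Mapping.lookup (pd1 f) (a, b, c) =
     (\<Sum>m\<in>Poly_Mapping.keys f. if m = (Suc a, b, c) then of_nat (Suc a) * Poly_Mapping.lookup f (Suc a, b, c) else 0)"
    unfolding pd1_def lookup_sum
    by (rule sum.cong) (auto simp: lookup_single when_def eq_Suc_pred_iff split: prod.splits)
  also have "\<dots> = of_nat (Suc a) * Poly_Mapping.lookup f (Suc a, b, c)"
    by (auto simp: sum.delta in_keys_iff)
  finally show ?thesis .
qed

lemma lookup_pd2:
  "Poly_Mapping.lookup (pd2 f) (a, b, c) = of_nat (Suc b) * Poly_Mapping.lookup f (a, Suc b, c)"
proof -
  have "Poly_Mapping.lookup (pd2 f) (a, b, c) =
     (\<Sum>m\<in>Poly_Mapping.keys f. if m = (a, Suc b, c) then of_nat (Suc b) * Poly_Mapping.lookup f (a, Suc b, c) else 0)"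
    unfolding pd2_def lookup_sum
    by (rule sum.cong) (auto simp: lookup_single when_def eq_Suc_pred_iff split: prod.splits)
  also have "\<dots> = of_nat (Suc b) * Poly_Mapping.lookup f (a, Suc b, c)"
    by (auto simp: sum.delta in_keys_iff)
  finally show ?thesis .
qed

lemma lookup_pd3:
  "Poly_Mapping.lookup (pd3 f) (a, b, c) = of_nat (Suc c) * Poly_Mapping.lookup f (a, b, Suc c)"
proof -
  have "Poly_Mapping.lookup (pd3 f) (a, b, c) =
     (\<Sum>m\<in>Poly_Mapping.keys f. if m = (a, b, Suc c) then of_nat (Suc c) * Poly_Mapping.lookup f (a, b, Suc c) else 0)"
    unfolding pd3_def lookup_sum
    by (rule sum.cong) (auto simp: lookup_single when_def eq_Suc_pred_iff split: prod.splits)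
  also have "\<dots> = of_nat (Suc c) * Poly_Mapping.lookup f (a, b, Suc c)"
    by (auto simp: sum.delta in_keys_iff)
  finally show ?thesis .
qed

definition derivation :: "(('k::comm_ring_1) poly3 \<Rightarrow> 'k poly3) \<Rightarrow> bool" where
  "derivation D \<longleftrightarrow> (\<forall>f g. D (f + g) = D f + D g) \<and> (\<forall>f g. D (f * g) = D f * g + f * D g) \<and>
     (\<forall>c. D (cst c) = 0)"

lemma pd_single:
  "pd1 (Poly_Mapping.single (a, b, c) k) = Poly_Mapping.single (a - 1, b, c) (of_nat a * k)"
  "pd2 (Poly_Mapping.single (a, b, c) k) = Poly_Mapping.single (a, b - 1, c) (of_nat b * k)"
  "pd3 (Poly_Mapping.single (a, b, c) k) = Poly_Mapping.single (a, b, c - 1) (of_nat c * k)"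
  by (cases "k = 0"; simp add: pd1_def pd2_def pd3_def)+

text \<open>Given additivity, both sides of the product rule are biadditive, so monomials
  suffice.\<close>

lemma derivationI:
  fixes D :: "('k::comm_ring_1) poly3 \<Rightarrow> 'k poly3"
  assumes add: "\<And>f g. D (f + g) = D f + D g"
    and mult: "\<And>m n a b. D (Poly_Mapping.single m a * Poly_Mapping.single n b) =
      D (Poly_Mapping.single m a) * Poly_Mapping.single n b + Poly_Mapping.single m a * D (Poly_Mapping.single n b)"
    and cst: "\<And>c. D (cst c) = 0"
  shows "derivation D"
proof -
  have *: "D (Poly_Mapping.single m a * g) = D (Poly_Mapping.single m a) * g + Poly_Mapping.single m a * D g" for m a g
    by (induction g rule: poly_mapping_single_induct) (simp_all add: mult add algebra_simps)
  have "D (f * g) = D f * g + f * D g" for f g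
    by (induction f rule: poly_mapping_single_induct) (simp add: *, simp add: add algebra_simps)
  then show ?thesis
    by (simp add: derivation_def add cst)
qed

lemma derivation_pd1: "derivation pd1"
proof (rule derivationI)
  fix m n :: mon3 and a b :: 'a
  show "pd1 (Poly_Mapping.single m a * Poly_Mapping.single n b) =
      pd1 (Poly_Mapping.single m a) * Poly_Mapping.single n b + Poly_Mapping.single m a * pd1 (Poly_Mapping.single n b)"
    \<comment> \<open>The exponent \<open>a - 1\<close> in \<open>pd1\<close> is truncated
      subtraction, so zero exponents are split off; there the coefficient \<open>of_nat a\<close>
      vanishes.\<close>
    by (cases m; cases n; cases "fst m"; cases "fst n")
      (auto simp: pd_single mult_single algebra_simps simp flip: single_add)
qed (auto intro!: poly_mapping_eqI simp: lookup_pd1 lookup_add algebra_simps lookup_single zero_prod_def when_def)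

lemma derivation_pd2: "derivation pd2"
proof (rule derivationI)
  fix m n :: mon3 and a b :: 'a
  show "pd2 (Poly_Mapping.single m a * Poly_Mapping.single n b) =
      pd2 (Poly_Mapping.single m a) * Poly_Mapping.single n b + Poly_Mapping.single m a * pd2 (Poly_Mapping.single n b)"
    by (cases m; cases n; cases "fst (snd m)"; cases "fst (snd n)")
      (auto simp: pd_single mult_single algebra_simps simp flip: single_add)
qed (auto intro!: poly_mapping_eqI simp: lookup_pd2 lookup_add algebra_simps lookup_single zero_prod_def when_def)

lemma derivation_pd3: "derivation pd3"
proof (rule derivationI)
  fix m n :: mon3 and a b :: 'a
  show "pd3 (Poly_Mapping.single m a * Poly_Mapping.single n b) =
      pd3 (Poly_Mapping.single m a) * Poly_Mapping.single n b + Poly_Mapping.single m a * pd3 (Poly_Mapping.single n b)"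
    by (cases m; cases n; cases "snd (snd m)"; cases "snd (snd n)")
      (auto simp: pd_single mult_single algebra_simps simp flip: single_add)
qed (auto intro!: poly_mapping_eqI simp: lookup_pd3 lookup_add algebra_simps lookup_single zero_prod_def when_def)

lemma var3_neq_0: "X1 \<noteq> 0" "X2 \<noteq> 0" "X3 \<noteq> 0"
  by (auto simp: var3_def dest: arg_cong[where f = Poly_Mapping.keys])

lemma derivationD:
  assumes "derivation D"
  shows derivation_add: "D (f + g) = D f + D g"
    and derivation_mult: "D (f * g) = D f * g + f * D g"
    and derivation_cst: "D (cst c) = 0"
  using assms by (simp_all add: derivation_def)

lemma derivation_0: "derivation D \<Longrightarrow> D 0 = 0"
  using derivation_cst[of D 0] by simp

lemma derivation_1: "derivation D \<Longrightarrow> D 1 = 0"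
  using derivation_cst[of D 1] by simp

lemma derivation_uminus: "derivation D \<Longrightarrow> D (- f) = - D f"
  by (metis derivation_0 derivation_add add.right_inverse add_eq_0_iff)

lemma derivation_diff: "derivation D \<Longrightarrow> D (f - g) = D f - D g"
  by (metis derivation_add diff_add_cancel add_diff_cancel_right')

lemma derivation_of_nat: "derivation D \<Longrightarrow> D (of_nat n) = 0"
  by (metis derivation_cst single_of_nat)

lemma derivation_power: "derivation D \<Longrightarrow> D (f ^ Suc n) = of_nat (Suc n) * f ^ n * D f"
proof (induction n)
  case (Suc n)
  have "D (f ^ Suc (Suc n)) = D f * f ^ Suc n + f * D (f ^ Suc n)"
    using derivation_mult[OF Suc.prems, of f "f ^ Suc n"] by simp
  then show ?case
    using Suc by (simp add: algebra_simps)
qed simp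

lemmas derivation_simps = derivation_add derivation_mult derivation_cst derivation_0 derivation_1
  derivation_uminus derivation_diff derivation_of_nat

lemma pd_var [simp]:
  "pd1 X1 = 1" "pd1 X2 = 0" "pd1 X3 = 0" "pd2 X1 = 0" "pd2 X2 = 1" "pd2 X3 = 0"
  "pd3 X1 = 0" "pd3 X2 = 0" "pd3 X3 = 1"
  by (simp_all add: var3_def pd_single zero_mon3)

text \<open>Both sides are derivations in \<open>f\<close>, so agreement on constants and variables
  suffices.\<close>

lemma derivation_eq_pd:
  fixes D :: "('k::comm_ring_1) poly3 \<Rightarrow> 'k poly3"
  assumes D: "derivation D"
  shows "D f = pd1 f * D X1 + pd2 f * D X2 + pd3 f * D X3"
proof (induction f rule: poly3_induct)
  case (mult f g)
  show ?case
    unfolding derivation_mult[OF D] derivation_mult[OF derivation_pd1]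
      derivation_mult[OF derivation_pd2] derivation_mult[OF derivation_pd3]
    by (subst mult(1), subst mult(2)) (simp add: algebra_simps)
qed (simp_all add: derivation_simps[OF D] derivation_simps[OF derivation_pd1]
  derivation_simps[OF derivation_pd2] derivation_simps[OF derivation_pd3] algebra_simps)

section \<open>Jacobian determinants and the chain rule\<close>

definition jac :: "('k::comm_ring_1) poly3 \<Rightarrow> 'k poly3 \<Rightarrow> 'k poly3 \<Rightarrow> 'k poly3" where
  "jac f g h = pd1 f * (pd2 g * pd3 h - pd3 g * pd2 h) + pd2 f * (pd3 g * pd1 h - pd1 g * pd3 h)
     + pd3 f * (pd1 g * pd2 h - pd2 g * pd1 h)"

lemma pbr_eq_jac: "pbr \<Omega> f g = jac f g \<Omega>"
  by (simp add: pbr_def jac_def algebra_simps)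

lemma derivation_jac: "derivation (jac f g)"
  by (simp add: derivation_def jac_def derivation_simps[OF derivation_pd1]
    derivation_simps[OF derivation_pd2] derivation_simps[OF derivation_pd3] algebra_simps)

lemma jac_swap: "jac f h g = - jac f g h" "jac g f h = - jac f g h"
  by (simp_all add: jac_def algebra_simps)

lemma jac_rotate: "jac g h f = jac f g h"
  by (simp add: jac_def algebra_simps)

lemma jac_same [simp]: "jac f g g = 0" "jac f f g = 0" "jac f g f = 0"
  by (simp_all add: jac_def algebra_simps)

lemma alg_homD:
  assumes "alg_hom_on UNIV h"
  shows alg_hom_add: "h (f + g) = h f + h g"
    and alg_hom_mult: "h (f * g) = h f * h g"
    and alg_hom_1: "h 1 = 1"
    and alg_hom_cst: "h (cst c) = cst c"
proof -
  show "h (f + g) = h f + h g" "h (f * g) = h f * h g" "h 1 = 1"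
    using assms by (auto simp: alg_hom_on_def)
  have "h (smult3 c 1) = smult3 c (h 1)"
    using assms unfolding alg_hom_on_def by blast
  then show "h (cst c) = cst c"
    using \<open>h 1 = 1\<close> by (simp add: smult3_def zero_mon3)
qed

lemma alg_hom_0: "alg_hom_on UNIV h \<Longrightarrow> h 0 = 0"
  using alg_hom_cst[of h 0] by simp

lemma alg_hom_uminus: "alg_hom_on UNIV h \<Longrightarrow> h (- f) = - h f"
  by (metis alg_hom_0 alg_hom_add add.right_inverse add_eq_0_iff)

lemma alg_hom_diff: "alg_hom_on UNIV h \<Longrightarrow> h (f - g) = h f - h g"
  by (metis alg_hom_add diff_add_cancel add_diff_cancel_right')

lemma alg_hom_sum: "alg_hom_on UNIV h \<Longrightarrow> h (sum f A) = (\<Sum>a\<in>A. h (f a))"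
  by (induction A rule: infinite_finite_induct) (simp_all add: alg_hom_0 alg_hom_add)

lemma alg_hom_eqI:
  assumes "alg_hom_on UNIV h" "alg_hom_on UNIV h'" "h X1 = h' X1" "h X2 = h' X2" "h X3 = h' X3"
  shows "h = h'"
proof
  show "h f = h' f" for f
    by (induction f rule: poly3_induct)
      (simp_all add: assms alg_homD[OF assms(1)] alg_homD[OF assms(2)])
qed

lemma derivation_alg_hom:
  fixes D :: "('k::comm_ring_1) poly3 \<Rightarrow> 'k poly3"
  assumes D: "derivation D" and h: "alg_hom_on UNIV h"
  shows "D (h f) = h (pd1 f) * D (h X1) + h (pd2 f) * D (h X2) + h (pd3 f) * D (h X3)"
proof (induction f rule: poly3_induct)
  case (mult f g)
  show ?case
    unfolding alg_hom_mult[OF h] derivation_mult[OF D] derivation_mult[OF derivation_pd1]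
      derivation_mult[OF derivation_pd2] derivation_mult[OF derivation_pd3] alg_hom_add[OF h]
    by (subst mult(1), subst mult(2)) (simp add: algebra_simps)
qed (simp_all add: derivation_simps[OF D] derivation_simps[OF derivation_pd1]
  derivation_simps[OF derivation_pd2] derivation_simps[OF derivation_pd3]
  alg_homD[OF h] alg_hom_0[OF h] algebra_simps)

text \<open>The chain rule factors the Jacobian matrix of the images, and determinants are
  multiplicative.\<close>

lemma jac_alg_hom:
  fixes h :: "('k::comm_ring_1) poly3 \<Rightarrow> 'k poly3"
  assumes h: "alg_hom_on UNIV h"
  shows "jac (h f) (h g) (h k) = h (jac f g k) * jac (h X1) (h X2) (h X3)"
proof -
  note d = derivation_alg_hom[OF derivation_pd1 h] derivation_alg_hom[OF derivation_pd2 h]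
    derivation_alg_hom[OF derivation_pd3 h]
  show ?thesis
    unfolding jac_def alg_hom_add[OF h] alg_hom_mult[OF h] alg_hom_diff[OF h]
      d[of f] d[of g] d[of k]
    by (simp add: algebra_simps)
qed

section \<open>Euler's identity and the grading\<close>

lemma lookup_X1_mult: "Poly_Mapping.lookup (X1 * f) (a, b, c) =
    (case a of 0 \<Rightarrow> 0 | Suc a' \<Rightarrow> Poly_Mapping.lookup f (a', b, c))"
  for f :: "('k::comm_ring_1) poly3"
  by (induction f rule: poly_mapping_single_induct)
    (auto simp: var3_def mult_single lookup_single when_def algebra_simps lookup_add split: nat.splits)

lemma lookup_X2_mult: "Poly_Mapping.lookup (X2 * f) (a, b, c) =
    (case b of 0 \<Rightarrow> 0 | Suc b' \<Rightarrow> Poly_Mapping.lookup f (a, b', c))"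
  for f :: "('k::comm_ring_1) poly3"
  by (induction f rule: poly_mapping_single_induct)
    (auto simp: var3_def mult_single lookup_single when_def algebra_simps lookup_add split: nat.splits)

lemma lookup_X3_mult: "Poly_Mapping.lookup (X3 * f) (a, b, c) =
    (case c of 0 \<Rightarrow> 0 | Suc c' \<Rightarrow> Poly_Mapping.lookup f (a, b, c'))"
  for f :: "('k::comm_ring_1) poly3"
  by (induction f rule: poly_mapping_single_induct)
    (auto simp: var3_def mult_single lookup_single when_def algebra_simps lookup_add split: nat.splits)

lemma lookup_X_pd:
  fixes f :: "('k::comm_ring_1) poly3"
  shows "Poly_Mapping.lookup (X1 * pd1 f) (a, b, c) = of_nat a * Poly_Mapping.lookup f (a, b, c)"
    "Poly_Mapping.lookup (X2 * pd2 f) (a, b, c) = of_nat b * Poly_Mapping.lookup f (a, b, c)"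
    "Poly_Mapping.lookup (X3 * pd3 f) (a, b, c) = of_nat c * Poly_Mapping.lookup f (a, b, c)"
  by (auto simp: lookup_X1_mult lookup_X2_mult lookup_X3_mult lookup_pd1 lookup_pd2 lookup_pd3 split: nat.splits)

lemma lookup_cst_mult: "Poly_Mapping.lookup (cst c * f) m = c * Poly_Mapping.lookup f m"
  for f :: "('k::comm_ring_1) poly3"
  by (induction f rule: poly_mapping_single_induct)
    (auto simp: mult_single lookup_single when_def algebra_simps lookup_add)

lemma mdeg_triple [simp]: "mdeg (a, b, c) = a + b + c"
  by (simp add: mdeg_def)

lemma mdeg_add: "mdeg (m + n) = mdeg m + mdeg n"
  by (cases m; cases n) simp

lemma homog_compD: "f \<in> homog_comp d \<Longrightarrow> Poly_Mapping.lookup f m \<noteq> 0 \<Longrightarrow> mdeg m = d"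
  by (simp add: homog_comp_def in_keys_iff)

lemma euler_homog:
  fixes f :: "('k::comm_ring_1) poly3"
  assumes "f \<in> homog_comp d"
  shows "X1 * pd1 f + X2 * pd2 f + X3 * pd3 f = of_nat d * f"
proof (rule poly_mapping_eqI)
  fix m :: mon3
  obtain a b c where m: "m = (a, b, c)" by (cases m)
  have "of_nat (a + b + c) * Poly_Mapping.lookup f m = of_nat d * Poly_Mapping.lookup f m"
    using homog_compD[OF assms, of m] by (cases "Poly_Mapping.lookup f m = 0") (auto simp: m)
  then show "Poly_Mapping.lookup (X1 * pd1 f + X2 * pd2 f + X3 * pd3 f) m = Poly_Mapping.lookup (of_nat d * f) m"
    unfolding single_of_nat[symmetric, where ?'b = 'k] lookup_cst_mult m
    by (simp add: lookup_add lookup_X_pd distrib_right)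
qed

lemma homog_comp_mult:
  assumes "f \<in> homog_comp d" "g \<in> homog_comp e"
  shows "f * g \<in> homog_comp (d + e)"
proof -
  have "mdeg m = d + e" if m: "m \<in> Poly_Mapping.keys (f * g)" for m
  proof -
    obtain a b where "m = a + b" "a \<in> Poly_Mapping.keys f" "b \<in> Poly_Mapping.keys g"
      using m keys_mult[of f g] by blast
    then show ?thesis
      using assms by (simp add: homog_comp_def mdeg_add)
  qed
  then show ?thesis by (simp add: homog_comp_def)
qed

lemma homog_comp_diff:
  fixes f g :: "('k::comm_ring_1) poly3"
  assumes "f \<in> homog_comp d" "g \<in> homog_comp d"
  shows "f - g \<in> homog_comp d"
proof -
  have "mdeg m = d" if "Poly_Mapping.lookup (f - g) m \<noteq> 0" for m
    using that homog_compD[OF assms(1), of m] homog_compD[OF assms(2), of m]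
    by (cases "Poly_Mapping.lookup f m = 0") (auto simp: lookup_minus)
  then show ?thesis
    by (simp add: homog_comp_def in_keys_iff)
qed

lemma cst_in_homog_comp: "cst c \<in> homog_comp 0"
  by (auto simp: homog_comp_def mdeg_def zero_prod_def split: if_splits)

lemma var_in_homog_comp: "X1 \<in> homog_comp 1" "X2 \<in> homog_comp 1" "X3 \<in> homog_comp 1"
  by (auto simp: homog_comp_def mdeg_def var3_def)

lemma homog_comp_0_imp_cst:
  assumes "f \<in> homog_comp 0"
  shows "f = cst (Poly_Mapping.lookup f 0)"
proof (rule poly_mapping_eqI)
  fix m
  show "Poly_Mapping.lookup f m = Poly_Mapping.lookup (cst (Poly_Mapping.lookup f 0)) m"
    using homog_compD[OF assms, of m]
    by (cases m; cases "Poly_Mapping.lookup f m = 0") (auto simp: lookup_single when_def zero_prod_def)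
qed

lemma homog_comp_degree_unique:
  assumes "f \<in> homog_comp d" "f \<in> homog_comp e" "f \<noteq> 0"
  shows "d = e"
  using assms(1,2) ldm_in_keys[OF assms(3)] unfolding homog_comp_def mem_Collect_eq by metis

lemma homog_comp_pd:
  fixes f :: "('k::comm_ring_1) poly3"
  assumes "f \<in> homog_comp (Suc d)"
  shows "pd1 f \<in> homog_comp d" "pd2 f \<in> homog_comp d" "pd3 f \<in> homog_comp d"
proof -
  have *: "mdeg m = Suc d" if "Poly_Mapping.lookup f m \<noteq> 0" for m
    using assms that by (auto simp: homog_comp_def in_keys_iff)
  have **: "y \<noteq> 0" if "x * y \<noteq> 0" for x y :: 'k
    using that by auto
  show "pd1 f \<in> homog_comp d" "pd2 f \<in> homog_comp d" "pd3 f \<in> homog_comp d"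
    by (auto simp: homog_comp_def in_keys_iff lookup_pd1 lookup_pd2 lookup_pd3 mdeg_def
      simp del: of_nat_Suc dest!: ** *)
qed

text \<open>In characteristic 0 every nonconstant monomial of \<open>f\<close> leaves a trace in
  some partial derivative; only the constant term is invisible there.\<close>

lemma homog_comp_of_pd:
  fixes f :: "('k::field_char_0) poly3"
  assumes "pd1 f \<in> homog_comp d" "pd2 f \<in> homog_comp d" "pd3 f \<in> homog_comp d"
    and "Poly_Mapping.lookup f 0 = 0"
  shows "f \<in> homog_comp (Suc d)"
proof -
  have "mdeg (a, b, c) = Suc d" if "Poly_Mapping.lookup f (a, b, c) \<noteq> 0" for a b c
  proof -
    have "(a, b, c) \<noteq> 0"
      using that assms(4) by metis
    then consider a' where "a = Suc a'" | b' where "b = Suc b'" | c' where "c = Suc c'"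
      by (cases a; cases b; cases c) (auto simp: zero_prod_def)
    then show ?thesis
    proof cases
      case 1
      then have "(a', b, c) \<in> Poly_Mapping.keys (pd1 f)"
        using that by (simp add: in_keys_iff lookup_pd1 del: of_nat_Suc)
      then show ?thesis using assms(1) 1 by (auto simp: homog_comp_def mdeg_def)
    next
      case 2
      then have "(a, b', c) \<in> Poly_Mapping.keys (pd2 f)"
        using that by (simp add: in_keys_iff lookup_pd2 del: of_nat_Suc)
      then show ?thesis using assms(2) 2 by (auto simp: homog_comp_def mdeg_def)
    next
      case 3
      then have "(a, b, c') \<in> Poly_Mapping.keys (pd3 f)"
        using that by (simp add: in_keys_iff lookup_pd3 del: of_nat_Suc)
      then show ?thesis using assms(3) 3 by (auto simp: homog_comp_def mdeg_def)
    qed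
  qed
  then show ?thesis
    by (auto simp: homog_comp_def in_keys_iff)
qed

section \<open>Linear forms\<close>

definition subst3 :: "'k::comm_ring_1 poly3 \<Rightarrow> 'k poly3 \<Rightarrow> 'k poly3 \<Rightarrow> 'k poly3 \<Rightarrow> 'k poly3" where
  "subst3 p q r f = (\<Sum>m\<in>Poly_Mapping.keys f.
     case m of (a, b, c) \<Rightarrow> cst (Poly_Mapping.lookup f m) * p ^ a * q ^ b * r ^ c)"

lemma subst3_single:
  "subst3 p q r (Poly_Mapping.single (a, b, c) k) = cst k * p ^ a * q ^ b * r ^ c"
  by (cases "k = 0") (simp_all add: subst3_def)

lemma alg_hom_subst3:
  fixes p q r :: "'k::comm_ring_1 poly3"
  shows "alg_hom_on UNIV (subst3 p q r)"
proof -
  have add: "subst3 p q r (f + g) = subst3 p q r f + subst3 p q r g" for f g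
    unfolding subst3_def
    by (rule setsum_keys_plus_distrib) (auto simp: single_add algebra_simps)
  have *: "subst3 p q r (Poly_Mapping.single m a * g) =
      subst3 p q r (Poly_Mapping.single m a) * subst3 p q r g" for m a g
  proof (induction g rule: poly_mapping_single_induct)
    case (single n b)
    obtain i j k where m: "m = (i, j, k)" by (cases m)
    obtain i' j' k' where n: "n = (i', j', k')" by (cases n)
    have "Poly_Mapping.single m a * Poly_Mapping.single n b = Poly_Mapping.single (i + i', j + j', k + k') (a * b)"
      by (simp add: m n mult_single)
    moreover have "cst (a * b) = cst a * (cst b :: 'k poly3)"
      by (simp add: mult_single)
    ultimately show ?case
      by (simp add: m n subst3_single power_add)
  qed (simp add: add algebra_simps)
  have mult: "subst3 p q r (f * g) = subst3 p q r f * subst3 p q r g" for f g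
    by (induction f rule: poly_mapping_single_induct) (simp add: *, simp add: add algebra_simps)
  have cst: "subst3 p q r (cst c) = cst c" for c
    using subst3_single[of p q r 0 0 0 c] by (simp add: zero_mon3)
  show ?thesis
    unfolding alg_hom_on_def smult3_def zero_mon3 using add mult cst cst[of 1] by simp
qed

lemma subst3_var: "subst3 p q r X1 = p" "subst3 p q r X2 = q" "subst3 p q r X3 = r"
  by (simp_all add: var3_def subst3_single)

definition lin :: "'k::comm_ring_1 poly3 \<Rightarrow> bool" where
  "lin l \<longleftrightarrow> l \<in> homog_comp 1 \<and> l \<noteq> 0"

lemma lin_pd_cst:
  assumes "lin l"
  shows "\<exists>a. pd1 l = cst a" "\<exists>a. pd2 l = cst a" "\<exists>a. pd3 l = cst a"
  using homog_comp_pd[of l 0] assms homog_comp_0_imp_cst unfolding lin_def One_nat_def by metis+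

lemma lin_eq:
  assumes "lin l"
  shows "l = X1 * pd1 l + X2 * pd2 l + X3 * pd3 l"
  using euler_homog[of l 1] assms by (simp add: lin_def)

lemma lin_pd_neq_0:
  assumes "lin l"
  shows "pd1 l \<noteq> 0 \<or> pd2 l \<noteq> 0 \<or> pd3 l \<noteq> 0"
  using lin_eq[OF assms] assms by (auto simp: lin_def)

lemma cst_mult_cst: "cst a * cst b = cst (a * b)"
  by (simp add: mult_single)

lemma cst_eq_0_iff [simp]: "cst a = 0 \<longleftrightarrow> a = 0"
  by (metis lookup_single_eq lookup_zero single_zero)

lemma cst_inverse: "a \<noteq> 0 \<Longrightarrow> cst (inverse a) * cst a = 1" for a :: "'k::field"
  by (simp add: mult_single)

text \<open>The projection along a vector \<open>v\<close> with \<open>l v = 1\<close> onto the plane \<open>l = 0\<close>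
  is an algebra endomorphism with kernel generated by \<open>l\<close>.\<close>

lemma lin_projection:
  fixes l :: "('k::field) poly3"
  assumes l: "lin l"
  obtains h where "alg_hom_on UNIV h" "\<And>f. l dvd f \<longleftrightarrow> h f = 0"
proof -
  obtain a1 a2 a3 where a: "pd1 l = cst a1" "pd2 l = cst a2" "pd3 l = cst a3"
    using lin_pd_cst[OF l] by blast
  have "\<exists>v1 v2 v3. v1 * a1 + v2 * a2 + v3 * a3 = 1"
    using lin_pd_neq_0[OF l] unfolding a cst_eq_0_iff
    by (metis add.left_neutral add.right_neutral left_inverse mult_zero_left)
  then obtain v1 v2 v3 where v: "v1 * a1 + v2 * a2 + v3 * a3 = 1"
    by blast
  define h where "h = subst3 (X1 - cst v1 * l) (X2 - cst v2 * l) (X3 - cst v3 * l)"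
  have h: "alg_hom_on UNIV h"
    unfolding h_def by (rule alg_hom_subst3)
  have hv: "h X1 = X1 - cst v1 * l" "h X2 = X2 - cst v2 * l" "h X3 = X3 - cst v3 * l"
    by (simp_all add: h_def subst3_var)
  have lx: "l = X1 * cst a1 + X2 * cst a2 + X3 * cst a3"
    using lin_eq[OF l] by (simp add: a)
  have "h l = h (X1 * cst a1 + X2 * cst a2 + X3 * cst a3)"
    by (subst lx) simp
  also have "\<dots> = (X1 * cst a1 + X2 * cst a2 + X3 * cst a3) - l * (cst v1 * cst a1 + cst v2 * cst a2 + cst v3 * cst a3)"
    by (simp add: alg_homD[OF h] hv algebra_simps)
  also have "\<dots> = 0"
    unfolding lx[symmetric] cst_mult_cst single_add[symmetric] v by simp
  finally have hl: "h l = 0" .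
  \<comment> \<open>\<open>h\<close> is the identity modulo \<open>l\<close> on the variables, hence
    everywhere.\<close>
  have "l dvd f - h f" for f
  proof (induction f rule: poly3_induct)
    case (add f g)
    have eq: "f + g - h (f + g) = (f - h f) + (g - h g)"
      by (simp add: alg_homD[OF h])
    show ?case unfolding eq using add by (rule dvd_add)
  next
    case (mult f g)
    have "f * g - h (f * g) = (f - h f) * g + h f * (g - h g)"
      by (simp add: alg_homD[OF h] algebra_simps)
    then show ?case using mult by simp
  qed (simp_all add: alg_homD[OF h] hv)
  moreover have "h f = 0" if "l dvd f" for f
    using that hl by (auto simp: dvd_def alg_homD[OF h])
  ultimately have "l dvd f \<longleftrightarrow> h f = 0" for f
    by (metis diff_zero)
  then show ?thesis using that h by blast
qed

lemma lin_not_dvd_cst: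
  fixes l :: "('k::idom) poly3"
  assumes l: "lin l" and "c \<noteq> 0"
  shows "\<not> l dvd cst c"
proof
  assume "l dvd cst c"
  then obtain d where "l = cst d"
    using mult_eq_cst_imp_cst assms(2) unfolding dvd_def by metis
  then show False
    using l homog_comp_degree_unique[of l 0 1] cst_in_homog_comp[of d] by (simp add: lin_def)
qed

text \<open>The projection maps into a domain, so its kernel, the ideal generated by
  \<open>l\<close>, is prime.\<close>

lemma lin_prime:
  fixes l :: "('k::field) poly3"
  assumes l: "lin l"
  shows "prime_elem l"
proof -
  obtain h where h: "alg_hom_on UNIV h" "\<And>f. l dvd f \<longleftrightarrow> h f = 0"
    using lin_projection[OF l] by blast
  have "l \<noteq> 0" using l by (simp add: lin_def)
  moreover have "\<not> l dvd 1" using lin_not_dvd_cst[OF l, of 1] by simp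
  ultimately show ?thesis
    unfolding prime_elem_def h(2) alg_hom_mult[OF h(1)] by simp
qed

lemma lin_associated:
  fixes l m :: "('k::field) poly3"
  assumes "lin l" "lin m" "l dvd m"
  shows "\<exists>c. c \<noteq> 0 \<and> m = cst c * l"
proof -
  obtain q where q: "m = l * q"
    using assms(3) by (auto elim: dvdE)
  have nz: "l \<noteq> 0" "q \<noteq> 0" using assms q by (auto simp: lin_def)
  have "ldm l + ldm q = ldm m" using ldm_mult[OF nz] q by simp
  moreover have "mdeg (ldm l) = 1" "mdeg (ldm m) = 1"
    using assms ldm_in_keys[of l] ldm_in_keys[of m] by (auto simp: lin_def homog_comp_def simp del: split_paired_All)
  ultimately have "mdeg (ldm q) = 0"
    using mdeg_add[of "ldm l" "ldm q"] by simp
  then have "ldm q = 0"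
    by (cases "ldm q") (simp add: zero_prod_def)
  then show ?thesis
    using ldm_eq_0_imp_cst[of q] q nz by (metis cst_eq_0_iff mult.commute)
qed

lemma prod_list_lin_homog:
  fixes ls :: "('k::comm_ring_1) poly3 list"
  assumes "\<And>l. l \<in> set ls \<Longrightarrow> lin l"
  shows "prod_list ls \<in> homog_comp (length ls)"
  using assms
proof (induction ls)
  case Nil
  show ?case using cst_in_homog_comp[of "1::'k"] by simp
next
  case (Cons l ls)
  then show ?case
    using homog_comp_mult[of l 1 "prod_list ls" "length ls"] by (simp add: lin_def)
qed

text \<open>This stands in for unique factorization: each \<open>l\<close> is prime, so it can be
  cancelled from one of the two factors, leaving a shorter list.\<close>

lemma divisor_prod_list_lin:
  fixes f g :: "('k::field) poly3"
  assumes "f * g = cst c * prod_list ls" "c \<noteq> 0" "\<And>l. l \<in> set ls \<Longrightarrow> lin l"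
  shows "\<exists>d ms. d \<noteq> 0 \<and> f = cst d * prod_list ms \<and> set ms \<subseteq> set ls"
  using assms
proof (induction ls arbitrary: f g)
  case Nil
  then obtain d where d: "f = cst d"
    using mult_eq_cst_imp_cst[of f g c] by auto
  with Nil have "d \<noteq> 0" by auto
  with d show ?case by (intro exI[of _ d] exI[of _ "[]"]) simp
next
  case (Cons l ls)
  have "lin l" using Cons.prems by simp
  then have "prime_elem l" "l \<noteq> 0"
    by (auto simp: lin_prime lin_def)
  moreover have "l dvd f * g"
    using Cons.prems(1) by simp
  ultimately consider "l dvd f" | "l dvd g"
    by (auto simp: prime_elem_dvd_mult_iff)
  then show ?case
  proof cases
    case 1
    then obtain f' where f': "f = l * f'" by (auto elim: dvdE)
    have "l * (f' * g) = l * (cst c * prod_list ls)"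
      using Cons.prems(1) f' by (simp add: algebra_simps)
    then obtain d ms where "d \<noteq> 0" "f' = cst d * prod_list ms" "set ms \<subseteq> set ls"
      using Cons.IH[of f' g] Cons.prems \<open>l \<noteq> 0\<close> by auto
    then show ?thesis
      by (intro exI[of _ d] exI[of _ "l # ms"]) (auto simp: f' algebra_simps)
  next
    case 2
    then obtain g' where g': "g = l * g'" by (auto elim: dvdE)
    have "l * (f * g') = l * (cst c * prod_list ls)"
      using Cons.prems(1) g' by (simp add: algebra_simps)
    then obtain d ms where "d \<noteq> 0" "f = cst d * prod_list ms" "set ms \<subseteq> set ls"
      using Cons.IH[of f g'] Cons.prems \<open>l \<noteq> 0\<close> by auto
    then show ?thesis by auto
  qed
qed

text \<open>The quotient \<open>h / g\<close> has zero differential, hence is constant in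
  characteristic 0. Comparing leading coefficients avoids fractions.\<close>

lemma proportional_of_pd:
  fixes g h :: "('k::field_char_0) poly3"
  assumes "h * pd1 g = g * pd1 h" "h * pd2 g = g * pd2 h" "h * pd3 g = g * pd3 h" and "g \<noteq> 0"
  shows "\<exists>c. h = cst c * g"
proof -
  let ?L = Poly_Mapping.lookup
  \<comment> \<open>This choice makes the coefficient of \<open>u\<close> at \<open>ldm g\<close>
    vanish, while a nonzero \<open>u\<close> will turn out to have
    \<open>ldm u = ldm g\<close>.\<close>
  define c where "c = ?L h (ldm g) / ?L g (ldm g)"
  define u where "u = h - cst c * g"
  have lg: "?L g (ldm g) \<noteq> 0"
    using ldm_in_keys[OF assms(4)] by (simp add: in_keys_iff)
  then have u0: "?L u (ldm g) = 0"
    by (simp add: u_def c_def lookup_minus lookup_cst_mult)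
  have "u = 0"
  proof (rule ccontr)
    assume "u \<noteq> 0"
    then have lu: "?L u (ldm u) \<noteq> 0"
      using ldm_in_keys[of u] by (simp add: in_keys_iff)
    obtain a1 a2 a3 where a: "ldm g = (a1, a2, a3)" by (cases "ldm g")
    obtain b1 b2 b3 where b: "ldm u = (b1, b2, b3)" by (cases "ldm u")
    \<comment> \<open>\<open>u\<close> satisfies the same relations as \<open>h\<close>. Multiplying
      by the variables turns partial derivatives into operators scaling each monomial by an
      exponent, so top coefficients compare the exponents of \<open>ldm g\<close> and
      \<open>ldm u\<close>.\<close>
    have *: "u * (X1 * pd1 g) = g * (X1 * pd1 u)" "u * (X2 * pd2 g) = g * (X2 * pd2 u)"
      "u * (X3 * pd3 g) = g * (X3 * pd3 u)"
      using assms(1,2,3) by (simp_all add: u_def derivation_simps[OF derivation_pd1]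
        derivation_simps[OF derivation_pd2] derivation_simps[OF derivation_pd3] algebra_simps)
    have k: "m \<in> Poly_Mapping.keys (X1 * pd1 f) \<Longrightarrow> m \<le> ldm f" "m \<in> Poly_Mapping.keys (X2 * pd2 f) \<Longrightarrow> m \<le> ldm f"
      "m \<in> Poly_Mapping.keys (X3 * pd3 f) \<Longrightarrow> m \<le> ldm f" for m and f :: "'k poly3"
      by (cases m; force simp: in_keys_iff lookup_X_pd intro: keys_le_ldm)+
    have "?L (u * (X1 * pd1 g)) (ldm u + ldm g) = ?L u (ldm u) * (of_nat a1 * ?L g (ldm g))"
      "?L (u * (X2 * pd2 g)) (ldm u + ldm g) = ?L u (ldm u) * (of_nat a2 * ?L g (ldm g))"
      "?L (u * (X3 * pd3 g)) (ldm u + ldm g) = ?L u (ldm u) * (of_nat a3 * ?L g (ldm g))"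
      by (subst lookup_mult_top; simp add: k keys_le_ldm; simp add: a lookup_X_pd)+
    moreover have "?L (g * (X1 * pd1 u)) (ldm g + ldm u) = ?L g (ldm g) * (of_nat b1 * ?L u (ldm u))"
      "?L (g * (X2 * pd2 u)) (ldm g + ldm u) = ?L g (ldm g) * (of_nat b2 * ?L u (ldm u))"
      "?L (g * (X3 * pd3 u)) (ldm g + ldm u) = ?L g (ldm g) * (of_nat b3 * ?L u (ldm u))"
      by (subst lookup_mult_top; simp add: k keys_le_ldm; simp add: b lookup_X_pd)+
    ultimately have "ldm g = ldm u"
      unfolding * using lu lg by (simp add: a b add.commute)
    then show False using lu u0 by simp
  qed
  then show ?thesis by (auto simp: u_def)
qed

text \<open>Multiplicity of the factor \<open>l\<close> in \<open>f\<close>; unspecified at \<open>f = 0\<close>.\<close>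

definition val :: "'k::comm_ring_1 poly3 \<Rightarrow> 'k poly3 \<Rightarrow> nat" where
  "val l f = (THE n. \<exists>u. f = l ^ n * u \<and> \<not> l dvd u)"

lemma val_eqI:
  fixes l :: "('k::field) poly3"
  assumes l: "lin l" and f: "f = l ^ n * u" and u: "\<not> l dvd u"
  shows "val l f = n"
  unfolding val_def
proof (rule the_equality)
  fix m assume "\<exists>w. f = l ^ m * w \<and> \<not> l dvd w"
  then obtain w where w: "f = l ^ m * w" "\<not> l dvd w" by blast
  have aux: "False" if "i < j" "l ^ i * a = l ^ j * b" "\<not> l dvd a" for i j a b
  proof -
    have "l ^ i * a = l ^ i * (l ^ (j - i) * b)"
      using that by (metis le_add_diff_inverse less_imp_le mult.assoc power_add)
    then have "a = l ^ (j - i) * b"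
      using l by (simp add: lin_def)
    then show False
      using that by (metis dvd_mult2 dvd_power zero_less_diff)
  qed
  show "m = n"
    using aux[of m n w u] aux[of n m u w] f w u by (metis linorder_neqE_nat)
qed (use f u in blast)

lemma mdeg_ldm_lin:
  assumes "lin l"
  shows "mdeg (ldm l) = 1"
  using assms ldm_in_keys[of l] by (auto simp: lin_def homog_comp_def simp del: split_paired_All)

text \<open>Each extracted factor \<open>l\<close> lowers the total degree of the leading monomial
  by one, so the extraction stops.\<close>

lemma val_decomp:
  fixes l :: "('k::field) poly3"
  assumes l: "lin l" and "f \<noteq> 0"
  obtains u where "f = l ^ val l f * u" "\<not> l dvd u"
proof -
  have "\<exists>n u. f = l ^ n * u \<and> \<not> l dvd u"
    using assms(2)
  proof (induction "mdeg (ldm f)" arbitrary: f rule: less_induct)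
    case less
    show ?case
    proof (cases "l dvd f")
      case True
      then obtain g where g: "f = l * g" by (auto elim: dvdE)
      have "g \<noteq> 0" using less g by auto
      then have "mdeg (ldm f) = 1 + mdeg (ldm g)"
        using g l ldm_mult[of l g] mdeg_ldm_lin[OF l] by (simp add: mdeg_add lin_def)
      then obtain n u where "g = l ^ n * u \<and> \<not> l dvd u"
        using less.hyps[of g] \<open>g \<noteq> 0\<close> by auto
      then show ?thesis
        using g by (intro exI[of _ "Suc n"] exI[of _ u]) (simp add: algebra_simps)
    next
      case False
      then show ?thesis by (intro exI[of _ 0] exI[of _ f]) simp
    qed
  qed
  then show ?thesis
    using val_eqI[OF l] that by metis
qed

lemma val_mult:
  fixes l :: "('k::field) poly3"
  assumes l: "lin l" and "f \<noteq> 0" "g \<noteq> 0"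
  shows "val l (f * g) = val l f + val l g"
proof -
  obtain u where u: "f = l ^ val l f * u" "\<not> l dvd u" using val_decomp[OF l assms(2)] .
  obtain w where w: "g = l ^ val l g * w" "\<not> l dvd w" using val_decomp[OF l assms(3)] .
  have "f * g = (l ^ val l f * u) * (l ^ val l g * w)"
    using u(1) w(1) by simp
  then have "f * g = l ^ (val l f + val l g) * (u * w)"
    by (simp add: power_add algebra_simps)
  moreover have "\<not> l dvd u * w"
    using u w lin_prime[OF l] by (simp add: prime_elem_dvd_mult_iff)
  ultimately show ?thesis by (rule val_eqI[OF l])
qed

lemma val_cst: "lin l \<Longrightarrow> c \<noteq> 0 \<Longrightarrow> val l (cst c) = 0" for l :: "('k::field) poly3"
  by (rule val_eqI) (auto simp: lin_not_dvd_cst)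

lemma val_power: "lin l \<Longrightarrow> f \<noteq> 0 \<Longrightarrow> val l (f ^ n) = n * val l f" for l :: "('k::field) poly3"
  using val_cst[of l 1] by (induction n) (simp_all add: val_mult)

lemma val_pos_iff:
  fixes l :: "('k::field) poly3"
  assumes l: "lin l" and "f \<noteq> 0"
  shows "0 < val l f \<longleftrightarrow> l dvd f"
proof
  obtain u where u: "f = l ^ val l f * u" "\<not> l dvd u" using val_decomp[OF assms] .
  show "l dvd f" if "0 < val l f"
    using u(1) that by (metis dvd_mult2 dvd_power)
  show "0 < val l f" if "l dvd f"
    using u that by (metis gr0I mult_1 power_0)
qed

lemma val_self: "lin l \<Longrightarrow> val l l = 1" for l :: "('k::field) poly3"
  by (rule val_eqI[of _ _ _ 1]) (use lin_not_dvd_cst[of l 1] in auto)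

lemma val_associated:
  fixes l m :: "('k::field) poly3"
  assumes "lin l" "lin m" "l dvd m"
  shows "val l m = 1"
  using lin_associated[OF assms] assms val_mult val_cst val_self
  by (metis add_0 cst_eq_0_iff lin_def)

section \<open>Integral extensions and orbit polynomials\<close>

lemma poly_dvd:
  fixes l :: "'a::comm_ring_1"
  assumes "\<And>i. l dvd coeff Q i"
  shows "l dvd poly Q f"
  unfolding poly_altdef by (intro dvd_sum dvd_mult2 assms)

lemma derivation_poly:
  fixes f :: "('k::idom) poly3"
  assumes D: "derivation D"
  shows "D (poly Q f) = poly (map_poly D Q) f + poly (pderiv Q) f * D f"
  by (induction Q) (simp_all add: derivation_simps[OF D] map_poly_pCons pderiv_pCons algebra_simps)

text \<open>Elements of \<open>k[x]\<close> are algebraic over the image of the subalgebra modulo \<open>l\<close>, so a derivation of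
  \<open>k[x]/(l)\<close> killing that image is zero: differentiate an algebraic relation of minimal degree.\<close>

lemma derivation_dvd_of_integral:
  fixes h :: "('k::field_char_0) poly3 \<Rightarrow> 'k poly3"
  assumes h: "alg_hom_on UNIV h"
    and int: "\<exists>Q. lead_coeff Q = 1 \<and> (\<forall>i. coeff Q i \<in> range h) \<and> poly Q f = 0"
    and l: "lin l" and D: "derivation D" and Dl: "l dvd D l"
    and Dh: "l dvd D (h X1)" "l dvd D (h X2)" "l dvd D (h X3)"
  shows "l dvd D f"
proof (rule ccontr)
  assume nd: "\<not> l dvd D f"
  \<comment> \<open>\<open>R Q\<close>: a relation for \<open>f\<close> modulo \<open>l\<close>,
    with coefficients in the image, that does not vanish identically modulo
    \<open>l\<close>.\<close>
  define R where "R Q \<longleftrightarrow> (\<forall>i. coeff Q i \<in> range h) \<and> l dvd poly Q f \<and> \<not> (\<forall>i. l dvd coeff Q i)" for Q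
  have "\<exists>Q. R Q"
  proof -
    obtain Q where Q: "lead_coeff Q = 1" "\<forall>i. coeff Q i \<in> range h" "poly Q f = 0"
      using int by blast
    have "\<not> l dvd coeff Q (degree Q)"
      using Q(1) lin_not_dvd_cst[OF l, of 1] by simp
    then have "R Q" using Q unfolding R_def by (metis dvd_0_right)
    then show ?thesis by blast
  qed
  then obtain Q where RQ: "R Q" and min: "\<And>Q'. R Q' \<Longrightarrow> degree Q \<le> degree Q'"
    using ex_has_least_nat[of R _ degree] by blast
  have Db: "l dvd D b" if b: "b \<in> range h" for b
  proof -
    obtain a where a: "b = h a" using b by blast
    show ?thesis
      using derivation_alg_hom[OF D h, of a] Dh by (simp only: a dvd_add dvd_mult)
  qed
  have "l dvd D (poly Q f)"
  proof -
    obtain q where q: "poly Q f = l * q" using RQ by (auto simp: R_def elim: dvdE)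
    show ?thesis unfolding q derivation_mult[OF D] using Dl by simp
  qed
  moreover have "l dvd poly (map_poly D Q) f"
    using RQ by (intro poly_dvd) (simp add: R_def coeff_map_poly derivation_0[OF D] Db)
  ultimately have "l dvd poly (pderiv Q) f * D f"
    using derivation_poly[OF D, of Q f] by (metis dvd_add_right_iff)
  then have p: "l dvd poly (pderiv Q) f"
    using nd lin_prime[OF l] by (simp add: prime_elem_dvd_mult_iff)
  have c: "coeff (pderiv Q) i \<in> range h" for i
  proof -
    obtain a where a: "coeff Q (Suc i) = h a" using RQ by (auto simp: R_def)
    have "coeff (pderiv Q) i = h (cst (of_nat (Suc i)) * a)"
      by (simp only: coeff_pderiv a alg_hom_mult[OF h] alg_hom_cst[OF h]) (simp only: single_of_nat)
    then show ?thesis by blast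
  qed
  have deg: "degree Q \<noteq> 0"
  proof
    assume "degree Q = 0"
    then obtain a where "Q = [:a:]" by (metis degree_eq_zeroE)
    then show False using RQ by (auto simp: R_def coeff_pCons split: nat.splits)
  qed
  then have "degree (pderiv Q) < degree Q"
    using degree_pderiv[of Q] by simp
  \<comment> \<open>By minimality all coefficients of \<open>pderiv Q\<close> are divisible by
    \<open>l\<close>. In characteristic 0 so are the nonconstant coefficients of \<open>Q\<close>,
    and then \<open>l dvd poly Q f\<close> forces the same for the constant one.\<close>
  then have "\<not> R (pderiv Q)" using min by fastforce
  then have *: "l dvd coeff (pderiv Q) i" for i
    using c p by (auto simp: R_def)
  have S: "l dvd coeff Q (Suc i)" for i
  proof -
    have "l dvd cst (of_nat (Suc i)) * coeff Q (Suc i)"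
      using *[of i] by (simp only: coeff_pderiv single_of_nat)
    moreover have "\<not> l dvd cst (of_nat (Suc i))"
      by (rule lin_not_dvd_cst[OF l]) (simp del: of_nat_Suc)
    ultimately show ?thesis
      using lin_prime[OF l] by (metis prime_elem_dvd_mult_iff)
  qed
  obtain a Q' where Q': "Q = pCons a Q'" by (cases Q)
  have "l dvd poly Q' f"
    using S by (intro poly_dvd) (simp add: Q')
  then have "l dvd a"
    using RQ by (simp add: R_def Q' dvd_add_left_iff)
  then have "l dvd coeff Q i" for i
    using S by (cases i) (simp_all add: Q')
  then show False using RQ by (simp add: R_def)
qed

section \<open>Orbit polynomials and their invariant coefficients\<close>

lemma map_poly_alg_hom_mult:
  fixes p q :: "('k::idom) poly3 poly"
  assumes h: "alg_hom_on UNIV h"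
  shows "map_poly h (p * q) = map_poly h p * map_poly h q"
  by (rule poly_eqI) (simp add: coeff_map_poly alg_hom_0[OF h] coeff_mult alg_hom_sum[OF h] alg_hom_mult[OF h])

lemma map_poly_alg_hom_prod:
  fixes p :: "'a \<Rightarrow> ('k::idom) poly3 poly"
  assumes h: "alg_hom_on UNIV h"
  shows "map_poly h (prod p A) = (\<Prod>a\<in>A. map_poly h (p a))"
  by (induction A rule: infinite_finite_induct)
    (simp_all add: map_poly_alg_hom_mult[OF h] map_poly_1' alg_hom_1[OF h])

definition orbit :: "('a \<Rightarrow> 'a) set \<Rightarrow> 'a \<Rightarrow> 'a set" where
  "orbit G f = (\<lambda>\<phi>. \<phi> f) ` G"

text \<open>The product runs over the orbit as a set, not over \<open>G\<close>: for a finite group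
  the roots are then distinct and the derivative at \<open>f\<close> is nonzero.\<close>

definition orbit_poly :: "(('k::idom) poly3 \<Rightarrow> 'k poly3) set \<Rightarrow> 'k poly3 \<Rightarrow> 'k poly3 poly" where
  "orbit_poly G f = (\<Prod>g\<in>orbit G f. [:- g, 1:])"

lemma self_in_orbit: "is_subgroup_fun G \<Longrightarrow> f \<in> orbit G f"
  unfolding is_subgroup_fun_def orbit_def by (metis id_apply image_eqI)

lemma lead_coeff_orbit_poly: "lead_coeff (orbit_poly G f) = 1"
  unfolding orbit_poly_def by (simp add: lead_coeff_prod)

lemma poly_orbit_poly_self:
  assumes "finite G" "is_subgroup_fun G"
  shows "poly (orbit_poly G f) f = 0"
  using assms self_in_orbit[OF assms(2), of f]
  by (auto simp: orbit_poly_def poly_prod orbit_def intro!: prod_zero)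

text \<open>Each element of \<open>G\<close> permutes the finite orbit and hence the factors of the
  product.\<close>

lemma coeff_orbit_poly_invariant:
  fixes G :: "(('k::idom) poly3 \<Rightarrow> 'k poly3) set"
  assumes G: "finite G" "is_subgroup_fun G" and hom: "\<And>\<phi>. \<phi> \<in> G \<Longrightarrow> alg_hom_on UNIV \<phi>"
  shows "coeff (orbit_poly G f) i \<in> invariants G"
proof -
  have "\<phi> (coeff (orbit_poly G f) i) = coeff (orbit_poly G f) i" if \<phi>: "\<phi> \<in> G" for \<phi>
  proof -
    note h = hom[OF \<phi>]
    have inj: "inj_on \<phi> (orbit G f)"
      using G \<phi> by (meson bij_is_inj inj_on_subset is_subgroup_fun_def subset_UNIV)
    have "\<phi> ` orbit G f \<subseteq> orbit G f"
      using G \<phi> by (auto simp: orbit_def is_subgroup_fun_def) (metis comp_apply image_eqI)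
    moreover have "finite (orbit G f)" using G by (simp add: orbit_def)
    ultimately have im: "\<phi> ` orbit G f = orbit G f"
      using inj by (simp add: endo_inj_surj)
    have "map_poly \<phi> (orbit_poly G f) = (\<Prod>g\<in>orbit G f. [:- \<phi> g, 1:])"
      unfolding orbit_poly_def map_poly_alg_hom_prod[OF h]
      by (simp add: map_poly_pCons alg_hom_0[OF h] alg_hom_1[OF h] alg_hom_uminus[OF h])
    also have "\<dots> = (\<Prod>g\<in>\<phi> ` orbit G f. [:- g, 1:])"
      by (simp add: prod.reindex[OF inj])
    finally have "map_poly \<phi> (orbit_poly G f) = orbit_poly G f"
      by (simp add: im orbit_poly_def)
    then show ?thesis
      by (metis coeff_map_poly alg_hom_0[OF h])
  qed
  then show ?thesis by (simp add: invariants_def)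
qed

lemma poly_pderiv_orbit_poly:
  assumes "finite G" "is_subgroup_fun G"
  shows "poly (pderiv (orbit_poly G f)) f = (\<Prod>g\<in>orbit G f - {f}. f - g)"
proof -
  have "orbit_poly G f = [:- f, 1:] * (\<Prod>g\<in>orbit G f - {f}. [:- g, 1:])"
    unfolding orbit_poly_def using assms self_in_orbit[OF assms(2), of f]
    by (intro prod.remove) (auto simp: orbit_def)
  then show ?thesis
    by (simp only: pderiv_mult pderiv_pCons poly_add poly_mult) (simp add: poly_prod)
qed

section \<open>Evaluation at the origin and Cramer's rule\<close>

lemma mon3_add_eq_0_iff: "m + n = 0 \<longleftrightarrow> m = 0 \<and> n = 0" for m n :: mon3
  by (cases m; cases n) (auto simp: zero_prod_def)

lemma lookup_mult_0:
  fixes f g :: "('k::comm_ring_1) poly3"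
  shows "Poly_Mapping.lookup (f * g) 0 = Poly_Mapping.lookup f 0 * Poly_Mapping.lookup g 0"
proof -
  have *: "Poly_Mapping.lookup (Poly_Mapping.single m a * g) 0 =
      Poly_Mapping.lookup (Poly_Mapping.single m a) 0 * Poly_Mapping.lookup g 0" for m and a :: 'k
    by (induction g rule: poly_mapping_single_induct)
      (auto simp: mult_single lookup_single when_def mon3_add_eq_0_iff lookup_add algebra_simps simp del: split_paired_All split_paired_Ex)
  show ?thesis
    by (induction f rule: poly_mapping_single_induct) (simp add: *, simp add: lookup_add algebra_simps)
qed

lemma lookup_0_homog:
  assumes "f \<in> homog_comp (Suc d)"
  shows "Poly_Mapping.lookup f 0 = 0"
  using homog_compD[OF assms, of 0] by (auto simp: zero_prod_def)

text \<open>The constant term is the value at the origin, and the polynomial map belonging to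
  \<open>h\<close> fixes the origin.\<close>

lemma alg_hom_lookup_0:
  fixes h :: "('k::comm_ring_1) poly3 \<Rightarrow> 'k poly3"
  assumes h: "alg_hom_on UNIV h"
    and "Poly_Mapping.lookup (h X1) 0 = 0" "Poly_Mapping.lookup (h X2) 0 = 0" "Poly_Mapping.lookup (h X3) 0 = 0"
  shows "Poly_Mapping.lookup (h f) 0 = Poly_Mapping.lookup f 0"
  by (induction f rule: poly3_induct)
    (simp_all add: assms alg_homD[OF h] lookup_add lookup_mult_0 lookup_0_homog[OF var_in_homog_comp(1)[unfolded One_nat_def]]
      lookup_0_homog[OF var_in_homog_comp(2)[unfolded One_nat_def]] lookup_0_homog[OF var_in_homog_comp(3)[unfolded One_nat_def]])

text \<open>Each identity combines the three equations with cofactors, that is, multiplies by the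
  adjugate matrix.\<close>

lemma cramer3:
  fixes v1 v2 v3 :: "'a::idom"
  assumes "a1 * v1 + a2 * v2 + a3 * v3 = 0" "b1 * v1 + b2 * v2 + b3 * v3 = 0" "c1 * v1 + c2 * v2 + c3 * v3 = 0"
    and det: "a1 * (b2 * c3 - b3 * c2) + a2 * (b3 * c1 - b1 * c3) + a3 * (b1 * c2 - b2 * c1) \<noteq> 0" (is "?d \<noteq> 0")
  shows "v1 = 0 \<and> v2 = 0 \<and> v3 = 0"
proof -
  have "?d * v1 = (b2 * c3 - b3 * c2) * (a1 * v1 + a2 * v2 + a3 * v3)
      + (c2 * a3 - c3 * a2) * (b1 * v1 + b2 * v2 + b3 * v3) + (a2 * b3 - a3 * b2) * (c1 * v1 + c2 * v2 + c3 * v3)"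
    by (simp add: algebra_simps)
  moreover have "?d * v2 = (b3 * c1 - b1 * c3) * (a1 * v1 + a2 * v2 + a3 * v3)
      + (c3 * a1 - c1 * a3) * (b1 * v1 + b2 * v2 + b3 * v3) + (a3 * b1 - a1 * b3) * (c1 * v1 + c2 * v2 + c3 * v3)"
    by (simp add: algebra_simps)
  moreover have "?d * v3 = (b1 * c2 - b2 * c1) * (a1 * v1 + a2 * v2 + a3 * v3)
      + (c1 * a2 - c2 * a1) * (b1 * v1 + b2 * v2 + b3 * v3) + (a1 * b2 - a2 * b1) * (c1 * v1 + c2 * v2 + c3 * v3)"
    by (simp add: algebra_simps)
  ultimately show ?thesis
    using det unfolding assms(1-3) by simp
qed

lemma alg_hom_graded_aut: "graded_poisson_aut \<Omega> \<phi> \<Longrightarrow> alg_hom_on UNIV \<phi>"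
  by (simp add: graded_poisson_aut_def)

lemma homog_comp_graded_aut: "graded_poisson_aut \<Omega> \<phi> \<Longrightarrow> f \<in> homog_comp d \<Longrightarrow> \<phi> f \<in> homog_comp d"
  unfolding graded_poisson_aut_def by blast

section \<open>Poisson endomorphisms onto rings of invariants\<close>

locale poisson_quotient =
  fixes \<Omega> :: "('k::field_char_0) poly3" and G :: "('k poly3 \<Rightarrow> 'k poly3) set"
    and \<sigma> :: "'k poly3 \<Rightarrow> 'k poly3"
  assumes pot_neq_0: "\<Omega> \<noteq> 0" and pot_homog: "\<Omega> \<in> homog_comp 3"
    and fin: "finite G" and grp: "is_subgroup_fun G"
    and aut: "\<And>\<phi>. \<phi> \<in> G \<Longrightarrow> graded_poisson_aut \<Omega> \<phi>"
    and hom: "alg_hom_on UNIV \<sigma>" and inj: "inj \<sigma>" and ran: "range \<sigma> = invariants G"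
    and poisson: "\<And>f g. \<sigma> (pbr \<Omega> f g) = pbr \<Omega> (\<sigma> f) (\<sigma> g)"
begin

abbreviation "y1 \<equiv> \<sigma> X1"
abbreviation "y2 \<equiv> \<sigma> X2"
abbreviation "y3 \<equiv> \<sigma> X3"

definition "J = jac y1 y2 y3"

lemma integral: "\<exists>Q. lead_coeff Q = 1 \<and> (\<forall>i. coeff Q i \<in> range \<sigma>) \<and> poly Q f = 0"
  using lead_coeff_orbit_poly poly_orbit_poly_self[OF fin grp] ran
    coeff_orbit_poly_invariant[OF fin grp alg_hom_graded_aut[OF aut]] by metis

lemma image_pd_pot: "\<sigma> (pd1 \<Omega>) = jac y2 y3 \<Omega>" "\<sigma> (pd2 \<Omega>) = jac y3 y1 \<Omega>" "\<sigma> (pd3 \<Omega>) = jac y1 y2 \<Omega>"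
  using poisson[of X2 X3] poisson[of X3 X1] poisson[of X1 X2]
  by (simp_all add: pbr_eq_jac jac_def[of X2 X3] jac_def[of X3 X1] jac_def[of X1 X2])

text \<open>The chain rule expands the left side in the \<open>\<sigma> (pd1 \<Omega>)\<close> and
  so on, which \<open>image_pd_pot\<close> turns into Jacobians; Cramer's rule for the gradients of
  \<open>y1\<close>, \<open>y2\<close>, \<open>y3\<close>, \<open>\<Omega>\<close> collapses the
  sum.\<close>

lemma derivation_image_pot:
  assumes D: "derivation D"
  shows "D (\<sigma> \<Omega>) = J * D \<Omega>"
proof -
  have "pd1 (\<sigma> \<Omega>) = J * pd1 \<Omega>" "pd2 (\<sigma> \<Omega>) = J * pd2 \<Omega>" "pd3 (\<sigma> \<Omega>) = J * pd3 \<Omega>"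
    unfolding derivation_alg_hom[OF derivation_pd1 hom, of \<Omega>] derivation_alg_hom[OF derivation_pd2 hom, of \<Omega>]
      derivation_alg_hom[OF derivation_pd3 hom, of \<Omega>] image_pd_pot J_def
    by (simp_all add: jac_def algebra_simps)
  then show ?thesis
    using derivation_eq_pd[OF D, of "\<sigma> \<Omega>"] derivation_eq_pd[OF D, of \<Omega>] by (simp add: algebra_simps)
qed

text \<open>The \<open>y1\<close>, \<open>y2\<close>, \<open>y3\<close> may have constant terms, so
  this is not immediate. Euler's identity expresses \<open>3 * \<Omega>\<close> by partial
  derivatives, whose images are Jacobians with \<open>\<Omega>\<close> and vanish at the
  origin.\<close>

lemma lookup_image_pot_0: "Poly_Mapping.lookup (\<sigma> \<Omega>) 0 = 0"
proof -
  have "Poly_Mapping.lookup (pd1 \<Omega>) 0 = 0" "Poly_Mapping.lookup (pd2 \<Omega>) 0 = 0" "Poly_Mapping.lookup (pd3 \<Omega>) 0 = 0"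
    using homog_comp_pd[of \<Omega> 2] pot_homog by (auto intro: lookup_0_homog[of _ 1] simp: numeral_2_eq_2 numeral_3_eq_3)
  then have "Poly_Mapping.lookup (jac f g \<Omega>) 0 = 0" for f g
    by (simp add: jac_def lookup_add lookup_minus lookup_mult_0)
  then have "Poly_Mapping.lookup (\<sigma> (X1 * pd1 \<Omega> + X2 * pd2 \<Omega> + X3 * pd3 \<Omega>)) 0 = 0"
    by (simp add: alg_homD[OF hom] image_pd_pot lookup_add lookup_mult_0)
  moreover have "X1 * pd1 \<Omega> + X2 * pd2 \<Omega> + X3 * pd3 \<Omega> = cst 3 * \<Omega>"
    using euler_homog[OF pot_homog] by simp
  ultimately have "Poly_Mapping.lookup (cst 3 * \<sigma> \<Omega>) 0 = 0"
    by (simp only: alg_homD[OF hom])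
  then show ?thesis
    by (simp only: lookup_cst_mult) simp
qed

text \<open>Apply \<open>D\<close> to the equation \<open>poly (orbit_poly G f) f = 0\<close>. The
  coefficients lie in the image of \<open>\<sigma>\<close>, so the chain rule expresses their
  derivatives by \<open>D y1\<close>, \<open>D y2\<close>, \<open>D y3\<close>, with coefficients
  independent of \<open>D\<close>.\<close>

lemma orbit_relation:
  "\<exists>a1 a2 a3. \<forall>D. derivation D \<longrightarrow>
     (\<Prod>g\<in>orbit G f - {f}. f - g) * D f = a1 * D y1 + a2 * D y2 + a3 * D y3"
proof -
  define s where "s = inv_into UNIV \<sigma>"
  have s: "\<sigma> (s b) = b" if "b \<in> range \<sigma>" for b
    using that by (simp add: s_def f_inv_into_f)
  \<comment> \<open>\<open>coeff_map_poly\<close> asks the mapped function to send \<open>0\<close>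
    to \<open>0\<close>.\<close>
  have s0: "s 0 = 0"
    using inv_f_f[OF inj, of 0] alg_hom_0[OF hom] by (simp add: s_def)
  let ?Q = "orbit_poly G f"
  have co: "coeff ?Q i \<in> range \<sigma>" for i
    using coeff_orbit_poly_invariant[OF fin grp alg_hom_graded_aut[OF aut]] ran by metis
  define a1 where "a1 = - poly (map_poly (\<lambda>b. \<sigma> (pd1 (s b))) ?Q) f"
  define a2 where "a2 = - poly (map_poly (\<lambda>b. \<sigma> (pd2 (s b))) ?Q) f"
  define a3 where "a3 = - poly (map_poly (\<lambda>b. \<sigma> (pd3 (s b))) ?Q) f"
  have "(\<Prod>g\<in>orbit G f - {f}. f - g) * D f = a1 * D y1 + a2 * D y2 + a3 * D y3" if D: "derivation D" for D
  proof -
    have "map_poly D ?Q = smult (D y1) (map_poly (\<lambda>b. \<sigma> (pd1 (s b))) ?Q)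
        + smult (D y2) (map_poly (\<lambda>b. \<sigma> (pd2 (s b))) ?Q) + smult (D y3) (map_poly (\<lambda>b. \<sigma> (pd3 (s b))) ?Q)"
    proof (rule poly_eqI)
      fix i
      have "D (coeff ?Q i) = D (\<sigma> (s (coeff ?Q i)))" by (simp add: s co)
      also note derivation_alg_hom[OF D hom]
      finally show "coeff (map_poly D ?Q) i = coeff (smult (D y1) (map_poly (\<lambda>b. \<sigma> (pd1 (s b))) ?Q)
        + smult (D y2) (map_poly (\<lambda>b. \<sigma> (pd2 (s b))) ?Q) + smult (D y3) (map_poly (\<lambda>b. \<sigma> (pd3 (s b))) ?Q)) i"
        by (simp add: coeff_map_poly derivation_0[OF D] derivation_0[OF derivation_pd1] derivation_0[OF derivation_pd2]
          derivation_0[OF derivation_pd3] s0 alg_hom_0[OF hom] mult.commute)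
    qed
    then have "poly (map_poly D ?Q) f = - (a1 * D y1 + a2 * D y2 + a3 * D y3)"
      by (simp add: a1_def a2_def a3_def algebra_simps)
    moreover have "0 = poly (map_poly D ?Q) f + poly (pderiv ?Q) f * D f"
      using derivation_poly[OF D, of ?Q f] poly_orbit_poly_self[OF fin grp] derivation_0[OF D] by simp
    ultimately show ?thesis
      unfolding poly_pderiv_orbit_poly[OF fin grp] by (metis add_eq_0_iff minus_minus)
  qed
  then show ?thesis by blast
qed

lemma prod_orbit_lin:
  assumes "f \<in> homog_comp 1"
  shows "\<exists>ls. (\<Prod>g\<in>orbit G f - {f}. f - g) = prod_list ls \<and> (\<forall>l\<in>set ls. lin l)"
proof -
  have "finite (orbit G f - {f})" using fin by (simp add: orbit_def)
  then obtain gs where gs: "set gs = orbit G f - {f}" "distinct gs"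
    using finite_distinct_list by blast
  have "(\<Prod>g\<in>orbit G f - {f}. f - g) = prod_list (map (\<lambda>g. f - g) gs)"
    using gs by (simp add: prod.distinct_set_conv_list[symmetric])
  moreover have "lin l" if l: "l \<in> set (map (\<lambda>g. f - g) gs)" for l
    using l gs homog_comp_diff[OF assms] homog_comp_graded_aut[OF aut, OF _ assms] by (auto simp: lin_def orbit_def)
  ultimately show ?thesis by blast
qed

text \<open>The relations for the three variables say that a matrix of determinant \<open>K\<close>
  times the Jacobian matrix of the \<open>y1\<close>, \<open>y2\<close>, \<open>y3\<close> is
  diagonal. Taking determinants, \<open>J\<close> divides a product of linear forms.\<close>

lemma J_factorization:
  "\<exists>c ls. c \<noteq> 0 \<and> J = cst c * prod_list ls \<and> (\<forall>l\<in>set ls. lin l)"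
proof -
  let ?\<delta> = "\<lambda>f. \<Prod>g\<in>orbit G f - {f}. f - g"
  obtain a1 a2 a3 where a: "\<And>D. derivation D \<Longrightarrow> ?\<delta> X1 * D X1 = a1 * D y1 + a2 * D y2 + a3 * D y3"
    using orbit_relation[of X1] by blast
  obtain b1 b2 b3 where b: "\<And>D. derivation D \<Longrightarrow> ?\<delta> X2 * D X2 = b1 * D y1 + b2 * D y2 + b3 * D y3"
    using orbit_relation[of X2] by blast
  obtain c1 c2 c3 where c: "\<And>D. derivation D \<Longrightarrow> ?\<delta> X3 * D X3 = c1 * D y1 + c2 * D y2 + c3 * D y3"
    using orbit_relation[of X3] by blast
  define d1 d2 d3 where d: "d1 = ?\<delta> X1" "d2 = ?\<delta> X2" "d3 = ?\<delta> X3"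
  define K where "K = a1 * (b2 * c3 - b3 * c2) + a2 * (b3 * c1 - b1 * c3) + a3 * (b1 * c2 - b2 * c1)"
  note pds = derivation_pd1 derivation_pd2 derivation_pd3
  have A: "a1 * pd1 y1 + a2 * pd1 y2 + a3 * pd1 y3 = d1" "a1 * pd2 y1 + a2 * pd2 y2 + a3 * pd2 y3 = 0"
    "a1 * pd3 y1 + a2 * pd3 y2 + a3 * pd3 y3 = 0"
    using a[OF pds(1)] a[OF pds(2)] a[OF pds(3)] by (simp_all add: d)
  have B: "b1 * pd1 y1 + b2 * pd1 y2 + b3 * pd1 y3 = 0" "b1 * pd2 y1 + b2 * pd2 y2 + b3 * pd2 y3 = d2"
    "b1 * pd3 y1 + b2 * pd3 y2 + b3 * pd3 y3 = 0"
    using b[OF pds(1)] b[OF pds(2)] b[OF pds(3)] by (simp_all add: d)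
  have C: "c1 * pd1 y1 + c2 * pd1 y2 + c3 * pd1 y3 = 0" "c1 * pd2 y1 + c2 * pd2 y2 + c3 * pd2 y3 = 0"
    "c1 * pd3 y1 + c2 * pd3 y2 + c3 * pd3 y3 = d3"
    using c[OF pds(1)] c[OF pds(2)] c[OF pds(3)] by (simp_all add: d)
  \<comment> \<open>Multiplicativity of the 3 by 3 determinant, written out.\<close>
  have mult_det: "(a1 * p1 + a2 * q1 + a3 * r1) * ((b1 * p2 + b2 * q2 + b3 * r2) * (c1 * p3 + c2 * q3 + c3 * r3)
        - (b1 * p3 + b2 * q3 + b3 * r3) * (c1 * p2 + c2 * q2 + c3 * r2))
      + (a1 * p2 + a2 * q2 + a3 * r2) * ((b1 * p3 + b2 * q3 + b3 * r3) * (c1 * p1 + c2 * q1 + c3 * r1)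
        - (b1 * p1 + b2 * q1 + b3 * r1) * (c1 * p3 + c2 * q3 + c3 * r3))
      + (a1 * p3 + a2 * q3 + a3 * r3) * ((b1 * p1 + b2 * q1 + b3 * r1) * (c1 * p2 + c2 * q2 + c3 * r2)
        - (b1 * p2 + b2 * q2 + b3 * r2) * (c1 * p1 + c2 * q1 + c3 * r1))
      = K * (p1 * (q2 * r3 - q3 * r2) + p2 * (q3 * r1 - q1 * r3) + p3 * (q1 * r2 - q2 * r1))"
    for p1 p2 p3 q1 q2 q3 r1 r2 r3
    by (simp add: K_def algebra_simps)
  have "J * K = d1 * d2 * d3"
    using mult_det[of "pd1 y1" "pd1 y2" "pd1 y3" "pd2 y1" "pd2 y2" "pd2 y3" "pd3 y1" "pd3 y2" "pd3 y3"]
    unfolding A B C J_def jac_def by (simp add: mult.commute mult.left_commute)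
  moreover obtain l1 l2 l3 where "d1 = prod_list l1" "d2 = prod_list l2" "d3 = prod_list l3"
    "\<forall>l\<in>set l1. lin l" "\<forall>l\<in>set l2. lin l" "\<forall>l\<in>set l3. lin l"
    using prod_orbit_lin[OF var_in_homog_comp(1)] prod_orbit_lin[OF var_in_homog_comp(2)]
      prod_orbit_lin[OF var_in_homog_comp(3)] unfolding d by metis
  ultimately have JK: "J * K = cst 1 * prod_list (l1 @ l2 @ l3)"
    and lin: "\<And>l. l \<in> set (l1 @ l2 @ l3) \<Longrightarrow> lin l"
    by (auto simp: algebra_simps)
  show ?thesis
    using divisor_prod_list_lin[OF JK one_neq_zero lin] lin by (meson subsetD)
qed

text \<open>The gradients of \<open>y1\<close>, \<open>y2\<close>, \<open>y3\<close> at the origin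
  form an invertible matrix. Differentiating the invariance of these elements there shows that each
  group element fixes the variables.\<close>

lemma trivial_of_J_cst:
  assumes J: "J = cst c" and c: "c \<noteq> 0"
  shows "G = {id}"
proof -
  let ?e = "\<lambda>f. Poly_Mapping.lookup f 0"
  have "\<phi> = id" if \<phi>: "\<phi> \<in> G" for \<phi>
  proof -
    note h = alg_hom_graded_aut[OF aut[OF \<phi>]]
    note hg = homog_comp_graded_aut[OF aut[OF \<phi>]]
    have inv: "\<phi> y1 = y1" "\<phi> y2 = y2" "\<phi> y3 = y3"
      using ran \<phi> by (auto simp: invariants_def)
    have e: "?e (\<phi> f) = ?e f" for f
      by (rule alg_hom_lookup_0[OF h]) (intro lookup_0_homog[of _ 0] hg var_in_homog_comp[unfolded One_nat_def])+
    have lin: "?e (D y1) = ?e (pd1 y1) * ?e (D (\<phi> X1)) + ?e (pd2 y1) * ?e (D (\<phi> X2)) + ?e (pd3 y1) * ?e (D (\<phi> X3))"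
      "?e (D y2) = ?e (pd1 y2) * ?e (D (\<phi> X1)) + ?e (pd2 y2) * ?e (D (\<phi> X2)) + ?e (pd3 y2) * ?e (D (\<phi> X3))"
      "?e (D y3) = ?e (pd1 y3) * ?e (D (\<phi> X1)) + ?e (pd2 y3) * ?e (D (\<phi> X2)) + ?e (pd3 y3) * ?e (D (\<phi> X3))"
      if D: "derivation D" for D
      using derivation_alg_hom[OF D h, of y1] derivation_alg_hom[OF D h, of y2] derivation_alg_hom[OF D h, of y3]
      by (simp_all add: inv lookup_add lookup_mult_0 e)
    have lin': "?e (D y1) = ?e (pd1 y1) * ?e (D X1) + ?e (pd2 y1) * ?e (D X2) + ?e (pd3 y1) * ?e (D X3)"
      "?e (D y2) = ?e (pd1 y2) * ?e (D X1) + ?e (pd2 y2) * ?e (D X2) + ?e (pd3 y2) * ?e (D X3)"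
      "?e (D y3) = ?e (pd1 y3) * ?e (D X1) + ?e (pd2 y3) * ?e (D X2) + ?e (pd3 y3) * ?e (D X3)"
      if D: "derivation D" for D
      using derivation_eq_pd[OF D, of y1] derivation_eq_pd[OF D, of y2] derivation_eq_pd[OF D, of y3]
      by (simp_all add: lookup_add lookup_mult_0)
    have det: "?e (pd1 y1) * (?e (pd2 y2) * ?e (pd3 y3) - ?e (pd3 y2) * ?e (pd2 y3))
      + ?e (pd2 y1) * (?e (pd3 y2) * ?e (pd1 y3) - ?e (pd1 y2) * ?e (pd3 y3))
      + ?e (pd3 y1) * (?e (pd1 y2) * ?e (pd2 y3) - ?e (pd2 y2) * ?e (pd1 y3)) \<noteq> 0"
      (is "?d \<noteq> 0")
    proof -
      have "?d = ?e J" by (simp only: J_def jac_def lookup_add lookup_minus lookup_mult_0)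
      then show ?thesis using J c by simp
    qed
    \<comment> \<open>Subtracting the two expansions \<open>lin\<close> and \<open>lin'\<close>
      gives a homogeneous linear system with nonzero determinant.\<close>
    have e0: "?e (D (\<phi> X1)) - ?e (D X1) = 0 \<and> ?e (D (\<phi> X2)) - ?e (D X2) = 0 \<and> ?e (D (\<phi> X3)) - ?e (D X3) = 0"
      if D: "derivation D" for D
      by (rule cramer3[OF _ _ _ det]) (use lin[OF D] lin'[OF D] in \<open>simp_all add: algebra_simps\<close>)
    have eq: "\<phi> f = f" if f: "f \<in> homog_comp 1"
      and "\<And>D. derivation D \<Longrightarrow> ?e (D (\<phi> f)) - ?e (D f) = 0" for f
    proof -
      let ?g = "\<phi> f - f"
      have g: "?g \<in> homog_comp (Suc 0)" using homog_comp_diff[OF hg[OF f] f] by simp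
      have "?e (pd1 ?g) = 0" "?e (pd2 ?g) = 0" "?e (pd3 ?g) = 0"
        using that(2)[OF derivation_pd1] that(2)[OF derivation_pd2] that(2)[OF derivation_pd3]
        by (simp_all add: derivation_diff[OF derivation_pd1] derivation_diff[OF derivation_pd2]
          derivation_diff[OF derivation_pd3] lookup_minus)
      then have "pd1 ?g = 0" "pd2 ?g = 0" "pd3 ?g = 0"
        using homog_comp_0_imp_cst[OF homog_comp_pd(1)[OF g]] homog_comp_0_imp_cst[OF homog_comp_pd(2)[OF g]]
          homog_comp_0_imp_cst[OF homog_comp_pd(3)[OF g]] by (metis single_zero)+
      then show ?thesis using euler_homog[OF g] by simp
    qed
    have "\<phi> X1 = X1" "\<phi> X2 = X2" "\<phi> X3 = X3"
      using e0 by (auto intro!: eq simp: var_in_homog_comp[unfolded One_nat_def])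
    then show ?thesis
      by (intro alg_hom_eqI[OF h]) (simp_all add: alg_hom_on_def)
  qed
  then show ?thesis using grp by (auto simp: is_subgroup_fun_def)
qed

end

section \<open>Jacobians of linear forms\<close>

lemma jac_lin_cst:
  assumes "lin f" "lin g" "lin h"
  shows "\<exists>c. jac f g h = cst c"
proof -
  obtain f1 f2 f3 g1 g2 g3 h1 h2 h3 where
    "pd1 f = cst f1" "pd2 f = cst f2" "pd3 f = cst f3" "pd1 g = cst g1" "pd2 g = cst g2" "pd3 g = cst g3"
    "pd1 h = cst h1" "pd2 h = cst h2" "pd3 h = cst h3"
    using lin_pd_cst[OF assms(1)] lin_pd_cst[OF assms(2)] lin_pd_cst[OF assms(3)] by metis
  then have "jac f g h = cst (f1 * (g2 * h3 - g3 * h2) + f2 * (g3 * h1 - g1 * h3) + f3 * (g1 * h2 - g2 * h1))"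
    by (simp only: jac_def cst_mult_cst single_add[symmetric] single_diff[symmetric])
  then show ?thesis by blast
qed

lemma lin_var: "lin X1" "lin X2" "lin X3"
  by (auto simp: lin_def var3_neq_0 var_in_homog_comp[unfolded One_nat_def])

text \<open>If all minors of the two gradients vanish, Euler's identity gives
  \<open>d l * m = d m * l\<close> for every partial derivative \<open>d\<close>; some
  \<open>d l\<close> is a nonzero constant, so \<open>l\<close> divides \<open>m\<close>.\<close>

lemma jac_lin_neq_0:
  fixes l m :: "('k::field) poly3"
  assumes l: "lin l" and m: "lin m" and nd: "\<not> l dvd m"
  shows "\<exists>w. lin w \<and> jac l m w \<noteq> 0"
proof (rule ccontr)
  assume "\<not> ?thesis"
  then have "jac l m X1 = 0" "jac l m X2 = 0" "jac l m X3 = 0"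
    using lin_var by blast+
  then have z: "pd2 l * pd3 m = pd3 l * pd2 m" "pd3 l * pd1 m = pd1 l * pd3 m" "pd1 l * pd2 m = pd2 l * pd1 m"
    by (simp_all add: jac_def)
  have "d l * m = d m * l" if d: "d = pd1 \<or> d = pd2 \<or> d = pd3" for d
  proof -
    have "d l * m = d l * (X1 * pd1 m + X2 * pd2 m + X3 * pd3 m)"
      using lin_eq[OF m] by simp
    also have "\<dots> = X1 * (d l * pd1 m) + X2 * (d l * pd2 m) + X3 * (d l * pd3 m)"
      by (simp add: algebra_simps)
    also have "\<dots> = X1 * (pd1 l * d m) + X2 * (pd2 l * d m) + X3 * (pd3 l * d m)"
      using d z by (auto simp: mult.commute)
    also have "\<dots> = d m * (X1 * pd1 l + X2 * pd2 l + X3 * pd3 l)"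
      by (simp add: algebra_simps)
    also have "\<dots> = d m * l" using lin_eq[OF l] by simp
    finally show ?thesis .
  qed
  moreover obtain d where d: "d = pd1 \<or> d = pd2 \<or> d = (pd3 :: 'k poly3 \<Rightarrow> _)" and "d l \<noteq> 0"
    using lin_pd_neq_0[OF l] by metis
  moreover obtain c where "d l = cst c"
    using lin_pd_cst[OF l] d by metis
  ultimately have "l dvd cst c * m" "c \<noteq> 0"
    by (metis dvd_triv_right, auto)
  then show False
    using lin_prime[OF l] nd lin_not_dvd_cst[OF l] by (metis prime_elem_dvd_mult_iff)
qed

text \<open>Cramer's rule for four gradients in a three-dimensional space, carried over to the forms
  by Euler's identity.\<close>

lemma jac_lin_relation:
  assumes "lin f" "lin g" "lin h" "lin w"
  shows "jac g h w * f + jac h f w * g + jac f g w * h = jac f g h * w"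
proof -
  have *: "jac g h w * pd1 f + jac h f w * pd1 g + jac f g w * pd1 h = jac f g h * pd1 w"
    "jac g h w * pd2 f + jac h f w * pd2 g + jac f g w * pd2 h = jac f g h * pd2 w"
    "jac g h w * pd3 f + jac h f w * pd3 g + jac f g w * pd3 h = jac f g h * pd3 w"
    by (simp_all add: jac_def algebra_simps)
  have "jac g h w * f + jac h f w * g + jac f g w * h =
    jac g h w * (X1 * pd1 f + X2 * pd2 f + X3 * pd3 f) + jac h f w * (X1 * pd1 g + X2 * pd2 g + X3 * pd3 g)
      + jac f g w * (X1 * pd1 h + X2 * pd2 h + X3 * pd3 h)"
    using lin_eq assms by metis
  also have "\<dots> = X1 * (jac g h w * pd1 f + jac h f w * pd1 g + jac f g w * pd1 h)
      + X2 * (jac g h w * pd2 f + jac h f w * pd2 g + jac f g w * pd2 h)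
      + X3 * (jac g h w * pd3 f + jac h f w * pd3 g + jac f g w * pd3 h)"
    by (simp only: algebra_simps)
  also have "\<dots> = jac f g h * (X1 * pd1 w + X2 * pd2 w + X3 * pd3 w)"
    unfolding * by (simp only: algebra_simps)
  also have "\<dots> = jac f g h * w"
    using lin_eq[OF assms(4)] by simp
  finally show ?thesis .
qed

lemma derivation_cst_mult_power:
  assumes D: "derivation D"
  shows "D (cst a * f ^ Suc m) = cst a * of_nat (Suc m) * f ^ m * D f"
  by (simp only: derivation_mult[OF D] derivation_cst[OF D] derivation_power[OF D]) (simp only: mult_zero_left add_0 mult.assoc)

lemma jac_powers:
  "jac (cst a * f ^ Suc m) (cst b * g ^ Suc m) (cst c * h ^ Suc m) =
    cst a * cst b * cst c * of_nat (Suc m) ^ 3 * (f * g * h) ^ m * jac f g h"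
proof -
  have "(p * p1) * ((q * q2) * (r * r3) - (q * q3) * (r * r2)) + (p * p2) * ((q * q3) * (r * r1) - (q * q1) * (r * r3))
     + (p * p3) * ((q * q1) * (r * r2) - (q * q2) * (r * r1)) =
     p * q * r * (p1 * (q2 * r3 - q3 * r2) + p2 * (q3 * r1 - q1 * r3) + p3 * (q1 * r2 - q2 * r1))"
    for p q r p1 p2 p3 q1 q2 q3 r1 r2 r3 :: "'a poly3"
    by (simp only: algebra_simps)
  note * = this[of "cst a * of_nat (Suc m) * f ^ m" _ "cst b * of_nat (Suc m) * g ^ m" _ "cst c * of_nat (Suc m) * h ^ m"]
  show ?thesis
    unfolding jac_def derivation_cst_mult_power[OF derivation_pd1] derivation_cst_mult_power[OF derivation_pd2]
      derivation_cst_mult_power[OF derivation_pd3] *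
    by (simp only: power_mult_distrib power3_eq_cube mult.assoc mult.left_commute mult.commute)
qed

section \<open>Ramification along a plane\<close>

context poisson_quotient
begin

text \<open>Otherwise the derivations \<open>jac l y\<^sub>i\<close>, and then all \<open>jac l g\<close>, would vanish modulo \<open>l\<close>.\<close>

lemma not_all_jac_dvd:
  assumes l: "lin l"
  shows "\<not> (l dvd jac l y2 y3 \<and> l dvd jac l y3 y1 \<and> l dvd jac l y1 y2)"
proof
  assume "l dvd jac l y2 y3 \<and> l dvd jac l y3 y1 \<and> l dvd jac l y1 y2"
  then have y: "l dvd jac l y2 y3" "l dvd jac l y3 y2" "l dvd jac l y3 y1" "l dvd jac l y1 y3"
    "l dvd jac l y1 y2" "l dvd jac l y2 y1"
    by (simp_all add: jac_swap(1)[of l y2 y3] jac_swap(1)[of l y3 y1] jac_swap(1)[of l y1 y2])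
  note T = derivation_dvd_of_integral[OF hom integral l derivation_jac]
  \<comment> \<open>\<open>T\<close> is applied twice: first to \<open>jac l y1\<close>,
    \<open>jac l y2\<close>, \<open>jac l y3\<close>, then, after a swap of arguments, to
    \<open>jac l g\<close> for arbitrary \<open>g\<close>.\<close>
  have "l dvd jac l y1 f" "l dvd jac l y2 f" "l dvd jac l y3 f" for f
    by (rule T; simp add: y)+
  then have gy: "l dvd jac l g y1" "l dvd jac l g y2" "l dvd jac l g y3" for g
    by (simp_all add: jac_swap(1)[of l g])
  have *: "l dvd jac l g f" for g f
    by (rule T) (simp_all add: gy)
  have "jac l X2 X3 = pd1 l" "jac l X3 X1 = pd2 l" "jac l X1 X2 = pd3 l"
    by (simp_all add: jac_def)
  then have "l dvd pd1 l" "l dvd pd2 l" "l dvd pd3 l"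
    using *[of X2 X3] *[of X3 X1] *[of X1 X2] by simp_all
  then show False
    using lin_pd_neq_0[OF l] lin_pd_cst[OF l] lin_not_dvd_cst[OF l] by (metis cst_eq_0_iff)
qed

lemma J_neq_0: "J \<noteq> 0"
  using J_factorization by (metis cst_eq_0_iff lin_def mult_eq_0_iff prod_list_zero_iff)

text \<open>If \<open>l\<close> divides \<open>\<sigma> m\<close> exactly \<open>b + 1\<close>
  times, then \<open>l ^ b\<close> divides all derivatives of \<open>\<sigma> m\<close>; by the
  chain rule some of these are nonzero constants times \<open>J\<close>. One more factor
  \<open>l\<close> in \<open>J\<close> would contradict \<open>not_all_jac_dvd\<close>.\<close>

lemma val_J:
  assumes l: "lin l" and m: "lin m" and dvd: "l dvd \<sigma> m"
  shows "val l (\<sigma> m) = Suc (val l J)"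
proof -
  have "\<sigma> m \<noteq> 0"
    using m inj alg_hom_0[OF hom] by (metis injD lin_def)
  then obtain u where u: "\<sigma> m = l ^ val l (\<sigma> m) * u" "\<not> l dvd u"
    using val_decomp[OF l] by blast
  obtain b where b: "val l (\<sigma> m) = Suc b"
    using val_pos_iff[OF l \<open>\<sigma> m \<noteq> 0\<close>] dvd by (metis gr0_conv_Suc)
  have z: "\<sigma> m = l ^ Suc b * u" using u(1) b by simp
  have D: "D (\<sigma> m) = l ^ b * (of_nat (Suc b) * u * D l + l * D u)" if D: "derivation D" for D
    unfolding z derivation_mult[OF D] derivation_power[OF D] by (simp add: algebra_simps)
  have J: "jac y2 y3 (\<sigma> m) = \<sigma> (pd1 m) * J" "jac y3 y1 (\<sigma> m) = \<sigma> (pd2 m) * J" "jac y1 y2 (\<sigma> m) = \<sigma> (pd3 m) * J"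
    using jac_alg_hom[OF hom, of X2 X3 m] jac_alg_hom[OF hom, of X3 X1 m] jac_alg_hom[OF hom, of X1 X2 m]
    by (simp_all add: J_def jac_def[of _ _ m])
  obtain a1 a2 a3 where a: "pd1 m = cst a1" "pd2 m = cst a2" "pd3 m = cst a3"
    using lin_pd_cst[OF m] by blast
  have J': "jac y2 y3 (\<sigma> m) = cst a1 * J" "jac y3 y1 (\<sigma> m) = cst a2 * J" "jac y1 y2 (\<sigma> m) = cst a3 * J"
    unfolding J a alg_hom_cst[OF hom] by simp_all
  have "l ^ b dvd jac f g (\<sigma> m)" for f g
    unfolding D[OF derivation_jac] by simp
  then have "l ^ b dvd cst a1 * J" "l ^ b dvd cst a2 * J" "l ^ b dvd cst a3 * J"
    using J' by metis+
  moreover have "a1 \<noteq> 0 \<or> a2 \<noteq> 0 \<or> a3 \<noteq> 0"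
    using lin_pd_neq_0[OF m] a by auto
  ultimately obtain a where "a \<noteq> 0" "l ^ b dvd cst a * J"
    by blast
  then have "l ^ b dvd cst (inverse a) * (cst a * J)"
    using dvd_mult by blast
  also have "cst (inverse a) * (cst a * J) = J"
    by (simp only: mult.assoc[symmetric] cst_inverse[OF \<open>a \<noteq> 0\<close>] mult_1)
  finally obtain w where w: "J = l ^ b * w" by (auto elim: dvdE)
  have "\<not> l dvd w"
  proof
    assume lw: "l dvd w"
    have jl: "l dvd jac f g l" if fg: "jac f g (\<sigma> m) = cst c * J" for f g c
    proof -
      \<comment> \<open>After cancelling \<open>l ^ b\<close>, neither \<open>u\<close> nor, in
        characteristic 0, \<open>of_nat (Suc b)\<close> is divisible by \<open>l\<close>, so
        \<open>jac f g l\<close> must be.\<close>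
      have "l ^ b * (of_nat (Suc b) * u * jac f g l + l * jac f g u) = l ^ b * (cst c * w)"
        using fg unfolding w D[OF derivation_jac] by (simp only: mult.left_commute)
      then have "of_nat (Suc b) * u * jac f g l + l * jac f g u = cst c * w"
        using l by (simp add: lin_def)
      then have "l dvd cst (of_nat (Suc b)) * u * jac f g l"
        using lw unfolding single_of_nat by (metis dvd_add_left_iff dvd_mult dvd_triv_left)
      moreover have "\<not> l dvd cst (of_nat (Suc b))"
        by (rule lin_not_dvd_cst[OF l]) (simp del: of_nat_Suc)
      ultimately show ?thesis
        using u(2) lin_prime[OF l] by (metis prime_elem_dvd_mult_iff)
    qed
    have "jac l y2 y3 = jac y2 y3 l" "jac l y3 y1 = jac y3 y1 l" "jac l y1 y2 = jac y1 y2 l"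
      by (simp_all add: jac_rotate)
    then show False
      using not_all_jac_dvd[OF l] J'[THEN jl] by simp
  qed
  then have "val l J = b" using val_eqI[OF l w] by blast
  then show ?thesis using b by simp
qed

end

section \<open>Factorization of the potential when \<open>J\<close> has positive degree\<close>

context poisson_quotient
begin

lemma image_lin_neq_0: "lin m \<Longrightarrow> \<sigma> m \<noteq> 0"
  using inj alg_hom_0[OF hom] by (metis injD lin_def)

context
  fixes N :: nat
  assumes J_homog: "J \<in> homog_comp N" and N_pos: "0 < N"
begin

text \<open>The partial derivatives of \<open>\<sigma> \<Omega>\<close> are \<open>J\<close> times
  those of \<open>\<Omega>\<close>, hence homogeneous of degree \<open>N + 2\<close>, and its
  constant term is zero. So Euler's identity applies to both potentials.\<close>

lemma image_pot_eq: "of_nat (N + 3) * \<sigma> \<Omega> = 3 * J * \<Omega>"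
proof -
  have "J * d \<Omega> \<in> homog_comp (N + 2)" if "d = pd1 \<or> d = pd2 \<or> d = pd3" for d
    using that homog_comp_mult[OF J_homog, of _ 2] homog_comp_pd[of \<Omega> 2] pot_homog by (auto simp: numeral_3_eq_3)
  then have "\<sigma> \<Omega> \<in> homog_comp (Suc (N + 2))"
    using derivation_image_pot[OF derivation_pd1] derivation_image_pot[OF derivation_pd2]
      derivation_image_pot[OF derivation_pd3]
    by (intro homog_comp_of_pd lookup_image_pot_0) metis+
  then have "of_nat (Suc (N + 2)) * \<sigma> \<Omega> = X1 * pd1 (\<sigma> \<Omega>) + X2 * pd2 (\<sigma> \<Omega>) + X3 * pd3 (\<sigma> \<Omega>)"
    by (simp only: euler_homog)
  also have "\<dots> = J * (X1 * pd1 \<Omega> + X2 * pd2 \<Omega> + X3 * pd3 \<Omega>)"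
    unfolding derivation_image_pot[OF derivation_pd1] derivation_image_pot[OF derivation_pd2]
      derivation_image_pot[OF derivation_pd3] by (simp add: algebra_simps)
  also have "\<dots> = 3 * J * \<Omega>"
    unfolding euler_homog[OF pot_homog] by simp
  finally show ?thesis by (simp add: add.commute)
qed

text \<open>Differentiate \<open>image_pot_eq\<close> and cancel the common term
  \<open>3 * J * D \<Omega>\<close>.\<close>

lemma log_derivation_J:
  assumes D: "derivation D"
  shows "of_nat N * J * D \<Omega> = 3 * \<Omega> * D J"
proof -
  have "D (of_nat (N + 3) * \<sigma> \<Omega>) = D (of_nat 3 * (J * \<Omega>))"
    unfolding image_pot_eq by (simp add: mult.assoc)
  then have "of_nat (N + 3) * (J * D \<Omega>) = of_nat 3 * (D J * \<Omega> + J * D \<Omega>)"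
    by (simp only: derivation_mult[OF D] derivation_of_nat[OF D] derivation_image_pot[OF D]) simp
  then show ?thesis
    by (simp add: algebra_simps)
qed

text \<open>By \<open>log_derivation_J\<close> the two powers have the same logarithmic
  derivatives.\<close>

lemma J_cubed: "\<exists>c. c \<noteq> 0 \<and> J ^ 3 = cst c * \<Omega> ^ N"
proof -
  obtain n where n: "N = Suc n" using N_pos gr0_conv_Suc by blast
  have "J ^ 3 * D (\<Omega> ^ N) = \<Omega> ^ N * D (J ^ 3)" if D: "derivation D" for D
  proof -
    have "J ^ 3 * D (\<Omega> ^ N) = J ^ 2 * \<Omega> ^ n * (of_nat N * J * D \<Omega>)"
      unfolding n derivation_power[OF D] by (simp add: power3_eq_cube power2_eq_square algebra_simps)
    also have "\<dots> = \<Omega> ^ N * (of_nat (Suc 2) * J ^ 2 * D J)"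
      unfolding log_derivation_J[OF D] by (simp add: n algebra_simps)
    finally show ?thesis
      by (simp only: derivation_power[OF D, symmetric] eval_nat_numeral)
  qed
  then obtain c where c: "J ^ 3 = cst c * \<Omega> ^ N"
    using proportional_of_pd[of "J ^ 3" "\<Omega> ^ N"] derivation_pd1 derivation_pd2 derivation_pd3 pot_neq_0
    by (metis power_not_zero)
  moreover have "c \<noteq> 0" using c J_neq_0 by auto
  ultimately show ?thesis by blast
qed

text \<open>Since \<open>N > 0\<close>, \<open>\<Omega>\<close> divides \<open>J ^ 3\<close> up to a
  scalar, hence is a product of linear forms. Its degree leaves three of them, and the scalar is
  absorbed into the first.\<close>

lemma pot_factorization: "\<exists>l1 l2 l3. lin l1 \<and> lin l2 \<and> lin l3 \<and> \<Omega> = l1 * l2 * l3"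
proof -
  obtain n where n: "N = Suc n" using N_pos gr0_conv_Suc by blast
  obtain b where b: "b \<noteq> 0" "J ^ 3 = cst b * \<Omega> ^ N" using J_cubed by blast
  obtain c ls where c: "c \<noteq> 0" "J = cst c * prod_list ls" and ls: "\<forall>l\<in>set ls. lin l"
    using J_factorization by blast
  have "\<Omega> * (cst b * \<Omega> ^ n) = J ^ 3"
    by (simp add: b n algebra_simps)
  also have "\<dots> = cst (c ^ 3) * prod_list (ls @ ls @ ls)"
    by (simp only: c power3_eq_cube cst_mult_cst[symmetric] prod_list.append mult.assoc mult.left_commute mult.commute)
  finally have "\<exists>d ms. d \<noteq> 0 \<and> \<Omega> = cst d * prod_list ms \<and> set ms \<subseteq> set (ls @ ls @ ls)"
    by (rule divisor_prod_list_lin) (use c ls in auto)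
  then obtain d ms where d: "d \<noteq> 0" "\<Omega> = cst d * prod_list ms" and ms: "\<And>l. l \<in> set ms \<Longrightarrow> lin l"
    using ls by auto
  have "\<Omega> \<in> homog_comp (0 + length ms)"
    unfolding d(2) by (intro homog_comp_mult cst_in_homog_comp prod_list_lin_homog ms)
  then have "length ms = 3"
    using homog_comp_degree_unique[OF pot_homog _ pot_neq_0] by simp
  then obtain m1 m2 m3 where m: "ms = [m1, m2, m3]"
    by (auto simp: numeral_3_eq_3 length_Suc_conv)
  have "lin (cst d * m1)"
    using ms[of m1] d(1) homog_comp_mult[OF cst_in_homog_comp, of m1 1 d] by (simp add: lin_def m)
  then show ?thesis
    using ms d(2) by (intro exI[of _ "cst d * m1"] exI[of _ m2] exI[of _ m3]) (simp add: m mult.assoc)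
qed

section \<open>Multiplicities of the linear factors\<close>

context
  fixes l1 l2 l3 :: "'k poly3"
  assumes lins: "lin l1" "lin l2" "lin l3" and pot_eq: "\<Omega> = l1 * l2 * l3"
begin

lemma image_pot_prod: "\<sigma> \<Omega> = \<sigma> l1 * \<sigma> l2 * \<sigma> l3"
  by (simp add: pot_eq alg_hom_mult[OF hom])

text \<open>Let \<open>V = val l J\<close> and \<open>\<mu> = val l \<Omega>\<close>. From
  \<open>image_pot_eq\<close> the three valuations sum to \<open>V + \<mu>\<close>, from
  \<open>J_cubed\<close> follows \<open>3 * V = N * \<mu>\<close>, and \<open>val_J\<close> makes
  each summand \<open>0\<close> or \<open>V + 1\<close>. As \<open>V > 0\<close> and
  \<open>0 < \<mu> \<le> 3\<close>, either one summand is nonzero and \<open>\<mu> = 1\<close>, or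
  two are and \<open>V = 1\<close>, \<open>\<mu> = 3\<close>.\<close>

lemma val_pot:
  assumes l: "lin l" and dvd: "l dvd \<Omega>"
  defines "e \<equiv> Suc (val l J)"
  shows "val l \<Omega> = 1" and "3 * val l J = N"
    and "(val l (\<sigma> l1), val l (\<sigma> l2), val l (\<sigma> l3)) \<in> {(e, 0, 0), (0, e, 0), (0, 0, e)}"
proof -
  note nz = image_lin_neq_0[OF lins(1)] image_lin_neq_0[OF lins(2)] image_lin_neq_0[OF lins(3)]
  have nz': "l1 \<noteq> 0" "l2 \<noteq> 0" "l3 \<noteq> 0" using lins by (auto simp: lin_def)
  have n: "of_nat (N + 3) \<noteq> (0::'k)" by (simp only: of_nat_eq_0_iff)
  have nF: "\<sigma> \<Omega> \<noteq> 0" using nz by (simp add: image_pot_prod)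
  have eq: "cst (of_nat (N + 3)) * \<sigma> \<Omega> = cst 3 * (J * \<Omega>)"
    using image_pot_eq by (simp only: single_of_nat single_numeral mult.assoc)
  have "val l (\<sigma> \<Omega>) = val l (cst (of_nat (N + 3)) * \<sigma> \<Omega>)"
    using n nF by (simp only: val_mult[OF l] val_cst[OF l] cst_eq_0_iff not_False_eq_True add_0)
  also have "\<dots> = val l J + val l \<Omega>"
    unfolding eq by (simp add: val_mult[OF l] val_cst[OF l] J_neq_0 pot_neq_0 del: single_numeral)
  finally have "val l (\<sigma> \<Omega>) = val l J + val l \<Omega>" .
  then have sum: "val l (\<sigma> l1) + val l (\<sigma> l2) + val l (\<sigma> l3) = val l J + val l \<Omega>"
    using nz by (simp add: image_pot_prod val_mult[OF l])
  obtain c where c: "c \<noteq> 0" "J ^ 3 = cst c * \<Omega> ^ N" using J_cubed by blast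
  have three: "3 * val l J = N * val l \<Omega>"
    using arg_cong[OF c(2), of "val l"] c(1)
    by (simp add: val_power[OF l] val_mult[OF l] val_cst[OF l] J_neq_0 pot_neq_0)
  have pos: "0 < val l \<Omega>" using dvd val_pos_iff[OF l pot_neq_0] by simp
  then have V: "0 < val l J" using three N_pos by (metis mult_is_0 neq0_conv)
  have a: "val l (\<sigma> m) = 0 \<or> val l (\<sigma> m) = e" if m: "lin m" for m
    using val_J[OF l m] val_pos_iff[OF l image_lin_neq_0[OF m]] by (auto simp: e_def)
  have v: "val l m = 0 \<or> (val l m = 1 \<and> l dvd m)" if m: "lin m" for m
    using val_associated[OF l m] val_pos_iff[OF l, of m] m by (auto simp: lin_def)
  have mu: "val l \<Omega> = val l l1 + val l l2 + val l l3"
    using nz' by (simp add: pot_eq val_mult[OF l])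
  \<comment> \<open>All three factors would be proportional to \<open>l\<close>, giving three equal
    summands, each \<open>0\<close> or \<open>V + 1\<close>, with sum \<open>V + 3\<close>; this is
    impossible for \<open>V > 0\<close>.\<close>
  have no_cube: False if "val l \<Omega> = 3"
  proof -
    have d: "l dvd l1" "l dvd l2" "l dvd l3"
      using v[OF lins(1)] v[OF lins(2)] v[OF lins(3)] mu that by auto
    have "val l (\<sigma> m) = val l (\<sigma> l)" if m: "lin m" "l dvd m" for m
    proof -
      obtain c where "c \<noteq> 0" "m = cst c * l" using lin_associated[OF l m] by blast
      then show ?thesis
        using image_lin_neq_0[OF l] by (simp add: alg_hom_mult[OF hom] alg_hom_cst[OF hom] val_mult[OF l] val_cst[OF l])
    qed
    then have "val l (\<sigma> l1) = val l (\<sigma> l)" "val l (\<sigma> l2) = val l (\<sigma> l)" "val l (\<sigma> l3) = val l (\<sigma> l)"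
      using d lins by blast+
    then show False
      using sum that V a[OF l] by (auto simp: e_def)
  qed
  have "val l \<Omega> \<le> 3" using mu v[OF lins(1)] v[OF lins(2)] v[OF lins(3)] by auto
  then have "val l \<Omega> = 1 \<and> (val l (\<sigma> l1), val l (\<sigma> l2), val l (\<sigma> l3)) \<in> {(e, 0, 0), (0, e, 0), (0, 0, e)}"
    using a[OF lins(1)] a[OF lins(2)] a[OF lins(3)] sum pos V no_cube unfolding e_def by auto
  then show "val l \<Omega> = 1" "3 * val l J = N"
    "(val l (\<sigma> l1), val l (\<sigma> l2), val l (\<sigma> l3)) \<in> {(e, 0, 0), (0, e, 0), (0, 0, e)}"
    using three by auto
qed

text \<open>The cube of \<open>image_pot_eq\<close> together with \<open>J_cubed\<close> makes
  \<open>(\<sigma> \<Omega>) ^ 3\<close> proportional to \<open>\<Omega> ^ (N + 3)\<close>, a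
  product of the \<open>l1\<close>, \<open>l2\<close>, \<open>l3\<close>. Injectivity of
  \<open>\<sigma>\<close> excludes an empty list.\<close>

lemma image_lin_factorization:
  assumes "lin m" "\<sigma> m dvd \<sigma> \<Omega>"
  shows "\<exists>d ms. d \<noteq> 0 \<and> ms \<noteq> [] \<and> \<sigma> m = cst d * prod_list ms \<and> set ms \<subseteq> {l1, l2, l3}"
proof -
  obtain r where r: "\<sigma> \<Omega> = \<sigma> m * r" using assms(2) by (auto elim: dvdE)
  obtain c where c: "c \<noteq> 0" "J ^ 3 = cst c * \<Omega> ^ N" using J_cubed by blast
  let ?ls = "concat (replicate (N + 3) [l1, l2, l3])"
  have ls: "prod_list (concat (replicate n [l1, l2, l3])) = \<Omega> ^ n" for n
    by (induction n) (simp_all add: pot_eq algebra_simps)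
  have set: "set (concat (replicate n [l1, l2, l3])) \<subseteq> {l1, l2, l3}" for n
    by (induction n) auto
  have "(of_nat (N + 3) * \<sigma> \<Omega>) ^ 3 = (3 * J * \<Omega>) ^ 3"
    by (simp only: image_pot_eq)
  also have "\<dots> = cst (27 * c) * \<Omega> ^ (N + 3)"
    using c(2) by (simp add: power_mult_distrib power_add cst_mult_cst[symmetric])
  finally have "\<sigma> m * (r * of_nat (N + 3) ^ 3 * \<sigma> \<Omega> ^ 2) = cst (27 * c) * prod_list ?ls"
    unfolding ls by (simp add: r power_mult_distrib power3_eq_cube power2_eq_square algebra_simps)
  then have "\<exists>d ms. d \<noteq> 0 \<and> \<sigma> m = cst d * prod_list ms \<and> set ms \<subseteq> set ?ls"
    by (rule divisor_prod_list_lin) (use c set[of "N + 3"] lins in auto)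
  then obtain d ms where d: "d \<noteq> 0" "\<sigma> m = cst d * prod_list ms" "set ms \<subseteq> {l1, l2, l3}"
    using set[of "N + 3"] by blast
  have "ms \<noteq> []"
  proof
    assume "ms = []"
    then have "\<sigma> m = \<sigma> (cst d)" using d by (simp add: alg_hom_cst[OF hom])
    then have "m = cst d" using inj by (simp add: inj_eq)
    then show False using assms(1) lin_not_dvd_cst[OF assms(1) d(1)] by simp
  qed
  then show ?thesis using d by blast
qed

text \<open>Each factor has multiplicity 1 in \<open>\<Omega>\<close>, and its own occurrence
  already accounts for that.\<close>

lemma factors_not_dvd:
  "\<not> (l1 dvd l2 \<or> l1 dvd l3 \<or> l2 dvd l1 \<or> l2 dvd l3 \<or> l3 dvd l1 \<or> l3 dvd l2)"
proof
  assume dvds: "l1 dvd l2 \<or> l1 dvd l3 \<or> l2 dvd l1 \<or> l2 dvd l3 \<or> l3 dvd l1 \<or> l3 dvd l2"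
  have nz: "l1 \<noteq> 0" "l2 \<noteq> 0" "l3 \<noteq> 0" using lins by (auto simp: lin_def)
  have dvd: "l1 dvd \<Omega>" "l2 dvd \<Omega>" "l3 dvd \<Omega>" by (simp_all add: pot_eq)
  have "val l l1 + val l l2 + val l l3 = 1" if "lin l" "l dvd \<Omega>" for l
    using val_pot(1)[OF that] nz by (simp add: pot_eq val_mult[OF that(1)])
  from this[OF lins(1) dvd(1)] this[OF lins(2) dvd(2)] this[OF lins(3) dvd(3)]
  have "\<not> 0 < val l1 l2" "\<not> 0 < val l1 l3" "\<not> 0 < val l2 l1" "\<not> 0 < val l2 l3" "\<not> 0 < val l3 l1" "\<not> 0 < val l3 l2"
    using val_self[OF lins(1)] val_self[OF lins(2)] val_self[OF lins(3)] by auto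
  then show False
    using dvds nz by (simp only: val_pos_iff lins not_False_eq_True) blast
qed

text \<open>The \<open>p1\<close>, \<open>p2\<close>, \<open>p3\<close> stand for a reordering of
  \<open>l1\<close>, \<open>l2\<close>, \<open>l3\<close>, of which only the product and the sign of
  the Jacobian matter here. Independent and dependent factors need different arguments.\<close>

lemma no_power_images:
  assumes p: "lin p1" "lin p2" "lin p3" and pot_p: "p1 * p2 * p3 = \<Omega>"
    and jac_p: "jac p1 p2 p3 = jac l1 l2 l3 \<or> jac p1 p2 p3 = - jac l1 l2 l3"
    and nd: "\<not> p1 dvd p3" "\<not> p2 dvd p3"
    and m: "0 < m" "3 * m = N"
    and im: "\<sigma> l1 = cst c1 * p1 ^ Suc m" "\<sigma> l2 = cst c2 * p2 ^ Suc m" "\<sigma> l3 = cst c3 * p3 ^ Suc m"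
  shows False
proof -
  define C where "C = cst c1 * cst c2 * cst c3"
  define n where "n = Suc m"
  have nz: "\<sigma> l1 \<noteq> 0" "\<sigma> l2 \<noteq> 0" "\<sigma> l3 \<noteq> 0" using image_lin_neq_0 lins by auto
  then have c: "c1 \<noteq> 0" "c2 \<noteq> 0" "c3 \<noteq> 0" using im by auto
  have "\<sigma> \<Omega> = C * (p1 * p2 * p3) ^ Suc m"
    unfolding image_pot_prod im C_def by (simp only: power_mult_distrib mult.assoc mult.left_commute mult.commute)
  then have F: "\<sigma> \<Omega> = C * \<Omega> ^ m * \<Omega>"
    unfolding pot_p by (simp add: algebra_simps)
  have "of_nat (N + 3) = (3 * of_nat n :: 'k poly3)"
    using m(2) by (simp add: n_def flip: m(2))
  then have "(3 * \<Omega>) * (of_nat n * C * \<Omega> ^ m) = (3 * \<Omega>) * J"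
    using image_pot_eq unfolding F by (simp only: mult.assoc mult.left_commute mult.commute)
  then have J: "J = of_nat n * C * \<Omega> ^ m"
    using pot_neq_0 by simp
  show False
  proof (cases "jac l1 l2 l3 = 0")
    case False
    \<comment> \<open>Computing the Jacobian of the images by the chain rule and by
      \<open>jac_powers\<close> will give \<open>n = n ^ 3\<close> up to sign, while
      \<open>n = Suc m\<close> is at least 2.\<close>
    obtain d where d: "jac l1 l2 l3 = cst d" using jac_lin_cst[OF lins] by blast
    have "jac (\<sigma> l1) (\<sigma> l2) (\<sigma> l3) = cst d * J"
      using jac_alg_hom[OF hom, of l1 l2 l3] by (simp add: J_def d alg_hom_cst[OF hom])
    moreover have "jac (\<sigma> l1) (\<sigma> l2) (\<sigma> l3) = C * of_nat n ^ 3 * \<Omega> ^ m * jac p1 p2 p3"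
      unfolding im jac_powers by (simp only: C_def n_def pot_p)
    ultimately have "(cst d * C * \<Omega> ^ m) * of_nat n = C * of_nat n ^ 3 * \<Omega> ^ m * jac p1 p2 p3"
      unfolding J by (simp only: mult.assoc mult.left_commute mult.commute)
    then have "(cst d * C * \<Omega> ^ m) * of_nat n = (cst d * C * \<Omega> ^ m) * of_nat n ^ 3 \<or>
        (cst d * C * \<Omega> ^ m) * of_nat n = (cst d * C * \<Omega> ^ m) * - (of_nat n ^ 3)"
      using jac_p unfolding d
      by (elim disjE) (simp_all only: mult_minus_right mult.assoc mult.left_commute mult.commute, simp_all)
    moreover have "cst d * C * \<Omega> ^ m \<noteq> 0"
      using False c pot_neq_0 by (simp add: d C_def)
    ultimately have "of_nat n = (of_nat n ^ 3 :: 'k poly3) \<or> of_nat n = (- (of_nat n ^ 3) :: 'k poly3)"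
      by (simp only: mult_cancel_left) blast
    then have "of_nat n = (of_nat (n ^ 3) :: 'k poly3) \<or> of_nat (n + n ^ 3) = (0 :: 'k poly3)"
      by (auto simp: eq_neg_iff_add_eq_0)
    then have "n = n ^ 3 \<or> n + n ^ 3 = 0"
      by (simp only: of_nat_eq_iff of_nat_eq_0_iff)
    moreover have "n * 1 < n * (n * n)"
      using m(1) by (intro mult_strict_left_mono) (simp_all add: n_def)
    ultimately show False
      by (simp add: power3_eq_cube)
  next
    case True
    have "\<not> l1 dvd l2" using factors_not_dvd by blast
    \<comment> \<open>This \<open>w\<close> makes the coefficient \<open>a3\<close> nonzero in the
      linear relation between the dependent factors.\<close>
    then obtain w where w: "lin w" "jac l1 l2 w \<noteq> 0"
      using jac_lin_neq_0 lins by blast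
    obtain a1 a2 a3 where a: "jac l2 l3 w = cst a1" "jac l3 l1 w = cst a2" "jac l1 l2 w = cst a3"
      using jac_lin_cst w lins by metis
    have "cst a1 * l1 + cst a2 * l2 + cst a3 * l3 = 0"
      using jac_lin_relation[OF lins w(1)] True a by simp
    then have "\<sigma> (cst a1 * l1 + cst a2 * l2 + cst a3 * l3) = 0"
      by (simp only: alg_hom_0[OF hom])
    then have rel: "cst a1 * \<sigma> l1 + cst a2 * \<sigma> l2 + cst a3 * \<sigma> l3 = 0"
      by (simp only: alg_homD[OF hom])
    \<comment> \<open>The derivation \<open>jac v p1\<close> kills \<open>p1\<close> and sends
      \<open>p3\<close> to a nonzero constant. The differentiated relation keeps two terms and shows
      that \<open>p2\<close> divides \<open>p3 ^ m\<close>.\<close>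
    obtain v where v: "lin v" "jac p1 p3 v \<noteq> 0"
      using jac_lin_neq_0 p nd by blast
    define D where "D = jac v p1"
    have D: "derivation D" unfolding D_def by (rule derivation_jac)
    obtain b where b: "D p3 = cst b" using jac_lin_cst v p unfolding D_def by blast
    have "b \<noteq> 0"
      using v(2) b by (auto simp: D_def jac_rotate)
    have "D p1 = 0" by (simp add: D_def)
    have "D (cst a1 * \<sigma> l1 + cst a2 * \<sigma> l2 + cst a3 * \<sigma> l3) = 0"
      unfolding rel by (rule derivation_0[OF D])
    then have "cst a2 * (cst c2 * of_nat n * p2 ^ m * D p2) + cst a3 * (cst c3 * of_nat n * p3 ^ m * cst b) = 0"
      unfolding im derivation_add[OF D] derivation_mult[OF D, of "cst _" "cst _ * _"] derivation_cst_mult_power[OF D]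
      by (simp add: derivation_cst[OF D] \<open>D p1 = 0\<close> b n_def del: of_nat_Suc)
    then have "p2 ^ m * (- cst a2 * cst c2 * of_nat n * D p2) = cst (a3 * c3 * of_nat n * b) * p3 ^ m"
      by (simp add: cst_mult_cst[symmetric] algebra_simps neg_eq_iff_add_eq_0)
    then have "p2 dvd cst (a3 * c3 * of_nat n * b) * p3 ^ m"
      using m(1) by (metis dvd_mult2 dvd_power)
    moreover have "a3 * c3 * of_nat n * b \<noteq> 0"
      using w(2) a c \<open>b \<noteq> 0\<close> by (simp add: n_def del: of_nat_Suc)
    ultimately have "p2 dvd p3 ^ m"
      using lin_prime[OF p(2)] lin_not_dvd_cst[OF p(2)] by (metis prime_elem_dvd_mult_iff)
    then show False
      using nd(2) lin_prime[OF p(2)] prime_elem_dvd_power by blast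
  qed
qed

lemma image_lin_power:
  assumes m: "lin m" "\<sigma> m dvd \<sigma> \<Omega>" and p: "p \<in> {l1, l2, l3}"
    and unique: "\<And>l. l \<in> {l1, l2, l3} \<Longrightarrow> 0 < val l (\<sigma> m) \<Longrightarrow> l = p"
  shows "\<exists>c. \<sigma> m = cst c * p ^ val p (\<sigma> m)"
proof -
  obtain d ms where d: "d \<noteq> 0" "\<sigma> m = cst d * prod_list ms" "set ms \<subseteq> {l1, l2, l3}"
    using image_lin_factorization[OF m] by blast
  have "l = p" if l: "l \<in> set ms" for l
  proof (rule unique)
    show "l \<in> {l1, l2, l3}" using l d by blast
    then have "lin l" using lins by blast
    moreover obtain xs ys where "ms = xs @ l # ys" using l by (meson split_list)
    then have "l dvd \<sigma> m" by (simp add: d(2))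
    ultimately show "0 < val l (\<sigma> m)" using val_pos_iff image_lin_neq_0[OF m(1)] by blast
  qed
  then have "ms = replicate (length ms) p" by (intro replicate_eqI) auto
  then have eq: "\<sigma> m = cst d * p ^ length ms" using d by (metis prod_list_replicate)
  have "lin p" using p lins by blast
  then have "val p (\<sigma> m) = length ms"
    using d(1) unfolding eq by (simp add: val_mult val_power val_cst val_self lin_def)
  then show ?thesis using eq by auto
qed

text \<open>In the 3 by 3 matrix of valuations of the images at the factors, each row has a single
  nonzero entry by \<open>val_pot\<close>, and no column is zero since each image has a factor among
  \<open>l1\<close>, \<open>l2\<close>, \<open>l3\<close>. So it is a multiple of a permutation
  matrix.\<close>

lemma absurd_of_factorization: False
proof -
  have dvd: "l1 dvd \<Omega>" "l2 dvd \<Omega>" "l3 dvd \<Omega>" by (simp_all add: pot_eq)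
  have sd: "\<sigma> l1 dvd \<sigma> \<Omega>" "\<sigma> l2 dvd \<sigma> \<Omega>" "\<sigma> l3 dvd \<sigma> \<Omega>" by (simp_all add: image_pot_prod)
  define m where "m = N div 3"
  have three: "3 * val l1 J = N" "3 * val l2 J = N" "3 * val l3 J = N"
    using val_pot(2) lins dvd by blast+
  then have m: "val l1 J = m" "val l2 J = m" "val l3 J = m" "3 * m = N" by (auto simp: m_def)
  have mpos: "0 < m" using m N_pos by auto
  have rows: "(val l1 (\<sigma> l1), val l1 (\<sigma> l2), val l1 (\<sigma> l3)) \<in> {(Suc m, 0, 0), (0, Suc m, 0), (0, 0, Suc m)}"
    "(val l2 (\<sigma> l1), val l2 (\<sigma> l2), val l2 (\<sigma> l3)) \<in> {(Suc m, 0, 0), (0, Suc m, 0), (0, 0, Suc m)}"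
    "(val l3 (\<sigma> l1), val l3 (\<sigma> l2), val l3 (\<sigma> l3)) \<in> {(Suc m, 0, 0), (0, Suc m, 0), (0, 0, Suc m)}"
    using val_pot(3)[OF lins(1) dvd(1)] val_pot(3)[OF lins(2) dvd(2)] val_pot(3)[OF lins(3) dvd(3)]
    unfolding m(1-3) by blast+
  have col: "val l1 (\<sigma> q) \<noteq> 0 \<or> val l2 (\<sigma> q) \<noteq> 0 \<or> val l3 (\<sigma> q) \<noteq> 0" if q: "lin q" "\<sigma> q dvd \<sigma> \<Omega>" for q
  proof -
    obtain d ms where d: "ms \<noteq> []" "\<sigma> q = cst d * prod_list ms" "set ms \<subseteq> {l1, l2, l3}"
      using image_lin_factorization[OF q] by blast
    then have "hd ms \<in> {l1, l2, l3}" "hd ms dvd \<sigma> q" by (auto simp: neq_Nil_conv)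
    moreover from this have "lin (hd ms)" using lins by blast
    ultimately have "hd ms \<in> {l1, l2, l3}" "0 < val (hd ms) (\<sigma> q)"
      using val_pos_iff image_lin_neq_0[OF q(1)] by blast+
    then show ?thesis by auto
  qed
  note cols = col[OF lins(1) sd(1)] col[OF lins(2) sd(2)] col[OF lins(3) sd(3)]
  have nd: "\<not> l1 dvd l2" "\<not> l1 dvd l3" "\<not> l2 dvd l1" "\<not> l2 dvd l3" "\<not> l3 dvd l1" "\<not> l3 dvd l2"
    using factors_not_dvd by blast+
  have pw: "\<exists>c. \<sigma> q = cst c * p ^ Suc m" if "lin q" "\<sigma> q dvd \<sigma> \<Omega>" "p \<in> {l1, l2, l3}" "val p (\<sigma> q) = Suc m"
    "\<And>l. l \<in> {l1, l2, l3} \<Longrightarrow> 0 < val l (\<sigma> q) \<Longrightarrow> l = p" for p q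
    using image_lin_power[OF that(1-3,5)] that(4) by auto
  have fin: False if "p1 \<in> {l1, l2, l3}" "p2 \<in> {l1, l2, l3}" "p3 \<in> {l1, l2, l3}" "p1 * p2 * p3 = \<Omega>"
    "jac p1 p2 p3 = jac l1 l2 l3 \<or> jac p1 p2 p3 = - jac l1 l2 l3" "\<not> p1 dvd p3" "\<not> p2 dvd p3"
    "val p1 (\<sigma> l1) = Suc m" "val p2 (\<sigma> l2) = Suc m" "val p3 (\<sigma> l3) = Suc m"
    "\<And>l. l \<in> {l1, l2, l3} \<Longrightarrow> 0 < val l (\<sigma> l1) \<Longrightarrow> l = p1"
    "\<And>l. l \<in> {l1, l2, l3} \<Longrightarrow> 0 < val l (\<sigma> l2) \<Longrightarrow> l = p2"
    "\<And>l. l \<in> {l1, l2, l3} \<Longrightarrow> 0 < val l (\<sigma> l3) \<Longrightarrow> l = p3" for p1 p2 p3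
  proof -
    note h = that
    obtain c1 c2 c3 where "\<sigma> l1 = cst c1 * p1 ^ Suc m" "\<sigma> l2 = cst c2 * p2 ^ Suc m" "\<sigma> l3 = cst c3 * p3 ^ Suc m"
      using pw[OF lins(1) sd(1) h(1,8,11)] pw[OF lins(2) sd(2) h(2,9,12)] pw[OF lins(3) sd(3) h(3,10,13)]
      by blast
    moreover have "lin p1" "lin p2" "lin p3" using that(1-3) lins by auto
    ultimately show False
      using no_power_images that(4-7) mpos m(4) by blast
  qed
  have jacs: "jac l1 l3 l2 = - jac l1 l2 l3" "jac l2 l1 l3 = - jac l1 l2 l3" "jac l3 l2 l1 = - jac l1 l2 l3"
    "jac l2 l3 l1 = jac l1 l2 l3" "jac l3 l1 l2 = jac l1 l2 l3"
    by (simp_all add: jac_def algebra_simps)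
  have prods: "l1 * l3 * l2 = \<Omega>" "l2 * l1 * l3 = \<Omega>" "l3 * l2 * l1 = \<Omega>" "l2 * l3 * l1 = \<Omega>" "l3 * l1 * l2 = \<Omega>"
    "l1 * l2 * l3 = \<Omega>"
    by (simp_all add: pot_eq algebra_simps)
  let ?v = "\<lambda>i j. val i (\<sigma> j) = Suc m"
  \<comment> \<open>The six permutation matrices.\<close>
  consider "?v l1 l1" "?v l2 l2" "?v l3 l3" | "?v l1 l1" "?v l3 l2" "?v l2 l3" | "?v l2 l1" "?v l1 l2" "?v l3 l3"
    | "?v l2 l1" "?v l3 l2" "?v l1 l3" | "?v l3 l1" "?v l1 l2" "?v l2 l3" | "?v l3 l1" "?v l2 l2" "?v l1 l3"
    using rows cols by auto
  then show False
  proof cases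
    case 1
    show ?thesis by (rule fin[of l1 l2 l3]) (use rows 1 in \<open>auto simp: prods jacs nd\<close>)
  next
    case 2
    show ?thesis by (rule fin[of l1 l3 l2]) (use rows 2 in \<open>auto simp: prods jacs nd\<close>)
  next
    case 3
    show ?thesis by (rule fin[of l2 l1 l3]) (use rows 3 in \<open>auto simp: prods jacs nd\<close>)
  next
    case 4
    show ?thesis by (rule fin[of l2 l3 l1]) (use rows 4 in \<open>auto simp: prods jacs nd\<close>)
  next
    case 5
    show ?thesis by (rule fin[of l3 l1 l2]) (use rows 5 in \<open>auto simp: prods jacs nd\<close>)
  next
    case 6
    show ?thesis by (rule fin[of l3 l2 l1]) (use rows 6 in \<open>auto simp: prods jacs nd\<close>)
  qed
qed

end
end
end

section \<open>Triviality of the group and reduction to the locale\<close>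

lemma (in poisson_quotient) group_trivial: "G = {id}"
proof -
  obtain c ls where c: "c \<noteq> 0" "J = cst c * prod_list ls" and ls: "\<forall>l\<in>set ls. lin l"
    using J_factorization by blast
  have homog: "J \<in> homog_comp (length ls)"
    unfolding c(2) using homog_comp_mult[OF cst_in_homog_comp prod_list_lin_homog] ls by fastforce
  show ?thesis
  proof (cases "ls = []")
    case True
    then show ?thesis using trivial_of_J_cst c by simp
  next
    case False
    then have "0 < length ls" by simp
    then show ?thesis
      using pot_factorization[OF homog] absurd_of_factorization[OF homog] by blast
  qed
qed

lemma poisson_quotient_inv_into:
  fixes \<Omega> :: "('k::field_char_0) poly3"
  assumes "\<Omega> \<noteq> 0" "\<Omega> \<in> homog_comp 3" "finite G" "is_subgroup_fun G"
    and aut: "\<forall>\<phi>\<in>G. graded_poisson_aut \<Omega> \<phi>"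
    and iso: "poisson_iso_onto_P \<Omega> (invariants G) \<psi>"
  shows "poisson_quotient \<Omega> G (inv_into (invariants G) \<psi>)"
proof -
  let ?B = "invariants G"
  define \<sigma> where "\<sigma> = inv_into ?B \<psi>"
  have bij: "bij_betw \<psi> ?B UNIV" and hom: "alg_hom_on ?B \<psi>"
    and br: "\<And>f g. f \<in> ?B \<Longrightarrow> g \<in> ?B \<Longrightarrow> \<psi> (pbr \<Omega> f g) = pbr \<Omega> (\<psi> f) (\<psi> g)"
    using iso by (auto simp: poisson_iso_onto_P_def)
  have in_B: "\<sigma> f \<in> ?B" and \<psi>\<sigma>: "\<psi> (\<sigma> f) = f" for f
    using bij by (auto simp: \<sigma>_def bij_betw_def f_inv_into_f inv_into_into)
  have \<sigma>\<psi>: "\<sigma> (\<psi> f) = f" if "f \<in> ?B" for f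
    using bij that by (auto simp: \<sigma>_def bij_betw_def)
  \<comment> \<open>\<open>\<sigma> f\<close> is the only invariant with image \<open>f\<close>
    under \<open>\<psi>\<close>, so identities for \<open>\<sigma>\<close> can be checked after
    applying \<open>\<psi>\<close>.\<close>
  have eqI: "\<sigma> f = g" if "g \<in> ?B" "\<psi> g = f" for f g
    using \<sigma>\<psi> that by auto
  \<comment> \<open>Group elements respect the operations and the bracket, so the invariants are
    closed under them; \<open>\<psi>\<close> is only known to be a homomorphism on
    invariants.\<close>
  have B: "1 \<in> ?B" "f + g \<in> ?B" "f * g \<in> ?B" "smult3 c f \<in> ?B" "pbr \<Omega> f g \<in> ?B"
    if "f \<in> ?B" "g \<in> ?B" for f g c
    using that aut unfolding invariants_def graded_poisson_aut_def alg_hom_on_def mem_Collect_eq by (metis UNIV_I)+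
  have "alg_hom_on UNIV \<sigma>"
    unfolding alg_hom_on_def
  proof (intro conjI ballI allI)
    show "\<sigma> 1 = 1"
      using B(1)[OF in_B in_B] hom by (intro eqI) (auto simp: alg_hom_on_def)
    show "\<sigma> (f + g) = \<sigma> f + \<sigma> g" "\<sigma> (f * g) = \<sigma> f * \<sigma> g" for f g
      using B[OF in_B in_B] hom in_B by (intro eqI; auto simp: alg_hom_on_def \<psi>\<sigma>)+
    show "\<sigma> (smult3 c f) = smult3 c (\<sigma> f)" for c f
      using B(4)[OF in_B in_B] hom in_B by (intro eqI) (auto simp: alg_hom_on_def \<psi>\<sigma>)
  qed
  moreover have "\<sigma> (pbr \<Omega> f g) = pbr \<Omega> (\<sigma> f) (\<sigma> g)" for f g
    using B(5)[OF in_B in_B] br in_B by (intro eqI) (auto simp: \<psi>\<sigma>)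
  moreover have "inj \<sigma>" using \<psi>\<sigma> by (metis injI)
  moreover have "range \<sigma> = ?B" using in_B \<sigma>\<psi> by (metis image_iff subsetI subset_antisym UNIV_I image_subset_iff)
  ultimately show ?thesis
    using assms by (simp add: poisson_quotient_def \<sigma>_def)
qed

theorem theorem3p1:
  fixes \<Omega> :: "('k::field_char_0) poly3"
    and G :: "('k poly3 \<Rightarrow> 'k poly3) set"
  assumes "alg_closed_field TYPE('k)"
    and "\<Omega> \<noteq> 0" and "\<Omega> \<in> homog_comp 3"
    and "finite G" and "is_subgroup_fun G"
    and "\<forall>\<phi>\<in>G. graded_poisson_aut \<Omega> \<phi>"
  shows "(\<exists>\<psi>. poisson_iso_onto_P \<Omega> (invariants G) \<psi>) \<longleftrightarrow> G = {id}"
proof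
  assume "\<exists>\<psi>. poisson_iso_onto_P \<Omega> (invariants G) \<psi>"
  then obtain \<psi> where "poisson_iso_onto_P \<Omega> (invariants G) \<psi>" by blast
  then show "G = {id}"
    using poisson_quotient.group_trivial[OF poisson_quotient_inv_into[OF assms(2-6)]] by blast
next
  assume "G = {id}"
  then have "poisson_iso_onto_P \<Omega> (invariants G) id"
    by (simp add: poisson_iso_onto_P_def invariants_def alg_hom_on_def)
  then show "\<exists>\<psi>. poisson_iso_onto_P \<Omega> (invariants G) \<psi>" by blast
qed

end
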